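(* Let $A=(c_{ij}x^{\alpha_{ij}})$ be an $s\times l$ multigraded squarefree matrix of uniform rank over $R=\Bbbk[x_1,\ldots,x_n]$, with $l\ge s$. For $i\in[s]$ let $$I_i=\langle\ \mathrm{lcm}(x^{\alpha_{ij_1}},\ldots,x^{\alpha_{ij_{s-i+1}}})\ :\ 1\le j_1<\cdots<j_{s-i+1}\le l\ \rangle .$$ Then the codimension of $M_A$ is equal to the least of the codimensions of the ideals $I_j$, i.e. $$\dim M_A=n-\min_{j\in[s]}\mathrm{codim}\,I_j .$$
   Context: $\Bbbk$ is a field of characteristic $0$, $R=\Bbbk[x_1,\ldots,x_n]$, $[t]=\{1,\ldots,t\}$, $x^\alpha=x_1^{a_1}\cdots x_n^{a_n}$ for $\alpha=(a_1,\dots,a_n)$. An $s\times l$ matrix $A=(c_{ij}x^{\alpha_{ij}})$ with $c_{ij}\in\Bbbk$, $\alpha_{ij}\in\mathbb N^n$ is multigraded if every minor of $A$ equals $c\,x^{\alpha}$ for some $c\in\Bbbk$ (possibly $0$) and some $\alpha\in\mathbb N^n$. It is of uniform rank if all of its minors (of all sizes) are nonzero. The system $E_A$ consists of the equations $\gamma_j-\beta_i=\alpha_{ij}$, one for each $(i,j)$ with $c_{ij}\ne0$, in the unknown vectors $\gamma_1,\ldots,\gamma_l,\beta_1,\ldots,\beta_s$. A multigraded matrix $A$ is squarefree if $E_A$ has a solution with all $\gamma_j,\beta_i\in\{0,1\}^n$. $M_A$ is the cokernel of the $R$-linear map $\phi:F_1\to F_0$, where $F_1$, $F_0$ are free with bases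 $\{w_j:j\in[l]\}$ and $\{v_i:i\in[s]\}$ and $\phi(w_j)=\sum_i c_{ij}x^{\alpha_{ij}}v_i$. $\dim$ is Krull dimension, and the codimension of an ideal $I$ is its height; conventions: $\mathrm{codim}\,R=\infty$ and the zero module has dimension $-\infty$. The codimension of $M_A$ is $n-\dim M_A$. *)

theory Defs
  imports
    Complex_Main
    "HOL-Library.Poly_Mapping"
    "HOL-Library.Extended_Real"
    "HOL-Library.Cardinality"
    "HOL-Algebra.QuotRing"
    "Jordan_Normal_Form.VS_Connect"
    "Jordan_Normal_Form.DL_Submatrix"
begin

section \<open>Krull dimension, codimension and cokernels\<close>

definition prime_chain :: "('a, 'b) ring_scheme \<Rightarrow> (nat \<Rightarrow> 'a set) \<Rightarrow> nat \<Rightarrow> bool" where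
  "prime_chain R P m \<longleftrightarrow>
     (\<forall>i\<le>m. primeideal (P i) R) \<and> (\<forall>i<m. P i \<subset> P (Suc i))"

text \<open>The zero ring has no prime ideals, so its dimension is the supremum of the empty set in
  \<^typ>\<open>ereal\<close>, namely \<open>-\<infinity>\<close>.\<close>

definition krull_dim :: "('a, 'b) ring_scheme \<Rightarrow> ereal" where
  "krull_dim R = (SUP m\<in>{m. \<exists>P. prime_chain R P m}. ereal (real m))"

definition prime_height :: "('a, 'b) ring_scheme \<Rightarrow> 'a set \<Rightarrow> ereal" where
  "prime_height R p = (SUP m\<in>{m. \<exists>P. prime_chain R P m \<and> P m = p}. ereal (real m))"

text \<open>For the unit ideal the infimum is over the empty set, so its codimension is \<open>\<infinity>\<close>.\<close>

definition ideal_codim :: "('a, 'b) ring_scheme \<Rightarrow> 'a set \<Rightarrow> ereal" where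
  "ideal_codim R I = (INF p\<in>{p. primeideal p R \<and> I \<subseteq> p}. prime_height R p)"

definition annihilator :: "('a, 'b) ring_scheme \<Rightarrow> ('a, 'm, 'c) module_scheme \<Rightarrow> 'a set" where
  "annihilator R M = {r \<in> carrier R. \<forall>x\<in>carrier M. r \<odot>\<^bsub>M\<^esub> x = \<zero>\<^bsub>M\<^esub>}"

definition module_dim :: "('a, 'b) ring_scheme \<Rightarrow> ('a, 'm, 'c) module_scheme \<Rightarrow> ereal" where
  "module_dim R M = krull_dim (R Quot annihilator R M)"

text \<open>A module record extends a ring record; its fields \<^const>\<open>monoid.mult\<close> and
  \<^const>\<open>monoid.one\<close> carry no meaning for a module, as in \<^const>\<open>module_vec\<close>.
  The scalar multiplication of cosets imitates \<^const>\<open>rcoset_mult\<close>.\<close>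

definition quot_module :: "('a, 'm, 'c) module_scheme \<Rightarrow> 'm set \<Rightarrow> ('a, 'm set) module" where
  "quot_module M N =
     \<lparr>carrier = a_rcosets\<^bsub>M\<^esub> N, monoid.mult = undefined, one = undefined,
      zero = N, add = set_add M,
      smult = (\<lambda>r X. \<Union>x\<in>X. N +>\<^bsub>M\<^esub> (r \<odot>\<^bsub>M\<^esub> x))\<rparr>"

text \<open>An \<open>s \<times> l\<close> matrix \<open>A\<close> represents the map \<open>F\<^sub>1 = R\<^sup>l \<rightarrow> F\<^sub>0 = R\<^sup>s\<close> sending the \<open>j\<close>-th
  basis vector to the \<open>j\<close>-th column of \<open>A\<close>.\<close>

definition mat_cokernel :: "'a::comm_ring_1 mat \<Rightarrow> ('a, 'a vec set) module" where
  "mat_cokernel A =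
     quot_module (module_vec TYPE('a) (dim_row A)) ((\<lambda>w. A *\<^sub>v w) ` carrier_vec (dim_col A))"

lemma submodule_abelian_subgroup:
  assumes "LinearCombinations.submodule R N M"
  shows "abelian_subgroup N M"
proof -
  interpret sub: LinearCombinations.submodule R N M by (rule assms)
  interpret Module.module R M by (rule sub.module)
  have N: "N \<subseteq> carrier M" by (rule sub.subset)
  have "subgroup N (add_monoid M)"
  proof
    show "N \<subseteq> carrier (add_monoid M)" using N by simp
    show "\<And>x y. \<lbrakk>x \<in> N; y \<in> N\<rbrakk> \<Longrightarrow> x \<otimes>\<^bsub>add_monoid M\<^esub> y \<in> N" by simp
    show "\<one>\<^bsub>add_monoid M\<^esub> \<in> N" by simp
    fix x assume "x \<in> N"
    then have "(\<ominus>\<^bsub>R\<^esub> \<one>\<^bsub>R\<^esub>) \<odot>\<^bsub>M\<^esub> x \<in> N" by simp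
    moreover have "(\<ominus>\<^bsub>R\<^esub> \<one>\<^bsub>R\<^esub>) \<odot>\<^bsub>M\<^esub> x = \<ominus>\<^bsub>M\<^esub> x"
      using \<open>x \<in> N\<close> N by (subst smult_l_minus) auto
    ultimately show "inv\<^bsub>add_monoid M\<^esub> x \<in> N" by (simp add: a_inv_def)
  qed
  then show ?thesis
    by (intro abelian_subgroupI3 additive_subgroup.intro) (auto intro: M.abelian_group_axioms)
qed

lemma quot_module_smult_coset:
  assumes "LinearCombinations.submodule R N M" "r \<in> carrier R" "x \<in> carrier M"
  shows "r \<odot>\<^bsub>quot_module M N\<^esub> (N +>\<^bsub>M\<^esub> x) = N +>\<^bsub>M\<^esub> (r \<odot>\<^bsub>M\<^esub> x)"
proof -
  interpret sub: LinearCombinations.submodule R N M by (rule assms)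
  interpret Module.module R M by (rule sub.module)
  interpret abelian_subgroup N M by (rule submodule_abelian_subgroup[OF assms(1)])
  have N: "N \<subseteq> carrier M" by (rule sub.subset)
  have *: "N +>\<^bsub>M\<^esub> (r \<odot>\<^bsub>M\<^esub> (h \<oplus>\<^bsub>M\<^esub> x)) = N +>\<^bsub>M\<^esub> (r \<odot>\<^bsub>M\<^esub> x)" if h: "h \<in> N" for h
  proof -
    have hc: "h \<in> carrier M" using h N by auto
    have rh: "r \<odot>\<^bsub>M\<^esub> h \<in> N" using h assms by simp
    have "r \<odot>\<^bsub>M\<^esub> (h \<oplus>\<^bsub>M\<^esub> x) = r \<odot>\<^bsub>M\<^esub> h \<oplus>\<^bsub>M\<^esub> r \<odot>\<^bsub>M\<^esub> x"
      using assms hc by (intro smult_r_distr) auto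
    then have "r \<odot>\<^bsub>M\<^esub> (h \<oplus>\<^bsub>M\<^esub> x) \<in> N +>\<^bsub>M\<^esub> (r \<odot>\<^bsub>M\<^esub> x)"
      using rh unfolding a_r_coset_def' by blast
    then show ?thesis
      using smult_closed[OF assms(2,3)] a_subgroup
      by (rule a_repr_independence[symmetric])
  qed
  have "r \<odot>\<^bsub>quot_module M N\<^esub> (N +>\<^bsub>M\<^esub> x) = (\<Union>y\<in>N +>\<^bsub>M\<^esub> x. N +>\<^bsub>M\<^esub> (r \<odot>\<^bsub>M\<^esub> y))"
    by (simp add: quot_module_def)
  also have "\<dots> = (\<Union>h\<in>N. N +>\<^bsub>M\<^esub> (r \<odot>\<^bsub>M\<^esub> (h \<oplus>\<^bsub>M\<^esub> x)))"
  proof -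
    have "N +>\<^bsub>M\<^esub> x = (\<lambda>h. h \<oplus>\<^bsub>M\<^esub> x) ` N" by (auto simp: a_r_coset_def')
    then show ?thesis by (simp only: image_image)
  qed
  also have "\<dots> = (\<Union>h\<in>N. N +>\<^bsub>M\<^esub> (r \<odot>\<^bsub>M\<^esub> x))" using * by (intro SUP_cong) auto
  also have "\<dots> = N +>\<^bsub>M\<^esub> (r \<odot>\<^bsub>M\<^esub> x)" using sub.zero_closed by blast
  finally show ?thesis .
qed

lemma quot_module_is_module:
  assumes "LinearCombinations.submodule R N M"
  shows "Module.module R (quot_module M N)"
proof -
  interpret sub: LinearCombinations.submodule R N M by (rule assms)
  interpret Module.module R M by (rule sub.module)
  interpret aas: abelian_subgroup N M by (rule submodule_abelian_subgroup[OF assms])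
  let ?Q = "quot_module M N"
  have cg: "comm_group (M A_Mod N)" by (rule aas.a_factorgroup_is_comm_group)
  have flds: "carrier ?Q = carrier (M A_Mod N)" "add ?Q = monoid.mult (M A_Mod N)"
      "zero ?Q = one (M A_Mod N)"
    by (simp_all add: quot_module_def A_FactGroup_def')
  interpret Q: comm_group "M A_Mod N" by (rule cg)
  have abg: "abelian_group ?Q"
    apply (rule abelian_groupI)
    unfolding flds
    apply (erule (1) Q.m_closed)
    apply (rule Q.one_closed)
    apply (erule (2) Q.m_assoc)
    apply (erule (1) Q.m_comm)
    apply (erule Q.l_one)
    apply (erule Q.l_inv_ex)
    done
  have car: "\<exists>x\<in>carrier M. X = N +>\<^bsub>M\<^esub> x" if "X \<in> carrier ?Q" for X
    using that by (auto simp: quot_module_def A_RCOSETS_def')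
  have car2: "N +>\<^bsub>M\<^esub> x \<in> carrier ?Q" if "x \<in> carrier M" for x
    using that by (auto simp: quot_module_def A_RCOSETS_def')
  have add: "(N +>\<^bsub>M\<^esub> x) \<oplus>\<^bsub>?Q\<^esub> (N +>\<^bsub>M\<^esub> y) = N +>\<^bsub>M\<^esub> (x \<oplus>\<^bsub>M\<^esub> y)"
    if "x \<in> carrier M" "y \<in> carrier M" for x y
    using that by (simp add: quot_module_def aas.a_rcos_sum)
  note sm = quot_module_smult_coset[OF assms]
  show ?thesis
  proof (rule moduleI[OF R.cring_axioms abg], goal_cases)
    case (1 a X) then show ?case by (auto dest!: car simp: sm car2)
  next
    case (2 a b X) then show ?case by (auto dest!: car simp: sm add smult_l_distr)
  next
    case (3 a X Y) then show ?case by (auto dest!: car simp: sm add smult_r_distr)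
  next
    case (4 a b X) then show ?case by (auto dest!: car simp: sm smult_assoc1)
  next
    case (5 X) then show ?case by (auto dest!: car simp: sm)
  qed
qed

lemma mat_range_submodule:
  fixes A :: "'a::comm_ring_1 mat"
  shows "LinearCombinations.submodule class_ring ((\<lambda>w. A *\<^sub>v w) ` carrier_vec (dim_col A))
     (module_vec TYPE('a) (dim_row A))"
proof -
  let ?m = "dim_row A" and ?n = "dim_col A"
  have A: "A \<in> carrier_mat ?m ?n" by simp
  have M: "Module.module class_ring (module_vec TYPE('a) ?m)"
  proof -
    interpret vec_module "TYPE('a)" ?m .
    show ?thesis by unfold_locales
  qed
  show ?thesis
  proof (rule LinearCombinations.submodule.intro[OF M], goal_cases)
    case 1 show ?case using mult_mat_vec_carrier[OF A] by (auto simp: module_vec_simps)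
  next
    case (2 v w)
    then obtain x y where "x \<in> carrier_vec ?n" "y \<in> carrier_vec ?n" "v = A *\<^sub>v x" "w = A *\<^sub>v y" by blast
    then have "v + w = A *\<^sub>v (x + y)" "x + y \<in> carrier_vec ?n"
      using mult_add_distrib_mat_vec[OF A] by auto
    then show ?case by (simp add: module_vec_simps)
  next
    case 3
    have "A *\<^sub>v 0\<^sub>v ?n = 0\<^sub>v ?m" by (intro eq_vecI) auto
    then show ?case by (simp add: module_vec_simps) (metis image_eqI zero_carrier_vec)
  next
    case (4 c v)
    then obtain x where "x \<in> carrier_vec ?n" "v = A *\<^sub>v x" by blast
    then have "c \<cdot>\<^sub>v v = A *\<^sub>v (c \<cdot>\<^sub>v x)" "c \<cdot>\<^sub>v x \<in> carrier_vec ?n"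
      by (auto intro!: eq_vecI simp: scalar_prod_def sum_distrib_left ac_simps)
    then show ?case by (simp add: module_vec_simps)
  qed
qed

lemma mat_cokernel_is_module: "Module.module class_ring (mat_cokernel A)"
  unfolding mat_cokernel_def by (rule quot_module_is_module[OF mat_range_submodule])

section \<open>Matrices with monomial entries\<close>

text \<open>The polynomial ring over \<open>'k\<close> whose variables are indexed by the finite type \<open>'n\<close>;
  an exponent vector is a \<^typ>\<open>'n \<Rightarrow>\<^sub>0 nat\<close>, and \<^term>\<open>Poly_Mapping.single a d\<close> is the term
  with coefficient \<open>d\<close> and exponent \<open>a\<close>.\<close>

type_synonym ('n, 'k) mpoly = "('n \<Rightarrow>\<^sub>0 nat) \<Rightarrow>\<^sub>0 'k"

text \<open>The data \<open>c\<close>, \<open>\<alpha>\<close> are indexed from 1, the entries of the type \<^typ>\<open>'a mat\<close> from 0.\<close>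

definition term_mat ::
    "nat \<Rightarrow> nat \<Rightarrow> (nat \<Rightarrow> nat \<Rightarrow> 'k) \<Rightarrow> (nat \<Rightarrow> nat \<Rightarrow> 'n \<Rightarrow>\<^sub>0 nat) \<Rightarrow> ('n, 'k::zero) mpoly mat" where
  "term_mat s l c \<alpha> = mat s l (\<lambda>(i, j). Poly_Mapping.single (\<alpha> (Suc i) (Suc j)) (c (Suc i) (Suc j)))"

text \<open>The empty minor, which equals 1, is harmlessly included in the next two definitions.\<close>

definition multigraded :: "('n, 'k::comm_ring_1) mpoly mat \<Rightarrow> bool" where
  "multigraded A \<longleftrightarrow>
     (\<forall>I J. I \<subseteq> {..<dim_row A} \<and> J \<subseteq> {..<dim_col A} \<and> card I = card J \<longrightarrow>
        (\<exists>a d. det (submatrix A I J) = Poly_Mapping.single a d))"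

definition uniform_rank :: "'a::comm_ring_1 mat \<Rightarrow> bool" where
  "uniform_rank A \<longleftrightarrow>
     (\<forall>I J. I \<subseteq> {..<dim_row A} \<and> J \<subseteq> {..<dim_col A} \<and> card I = card J \<longrightarrow>
        det (submatrix A I J) \<noteq> 0)"

text \<open>The system \<open>\<gamma>\<^sub>j - \<beta>\<^sub>i = \<alpha>\<^sub>i\<^sub>j\<close>, read coordinatewise over the integers, since subtraction on
  \<^typ>\<open>nat\<close> truncates.\<close>

definition solves_E ::
    "nat \<Rightarrow> nat \<Rightarrow> (nat \<Rightarrow> nat \<Rightarrow> 'k::zero) \<Rightarrow> (nat \<Rightarrow> nat \<Rightarrow> 'n \<Rightarrow>\<^sub>0 nat) \<Rightarrow>
      (nat \<Rightarrow> 'n \<Rightarrow> int) \<Rightarrow> (nat \<Rightarrow> 'n \<Rightarrow> int) \<Rightarrow> bool" where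
  "solves_E s l c \<alpha> \<gamma> \<beta> \<longleftrightarrow>
     (\<forall>i\<in>{1..s}. \<forall>j\<in>{1..l}. c i j \<noteq> 0 \<longrightarrow>
        (\<forall>v. \<gamma> j v - \<beta> i v = int (Poly_Mapping.lookup (\<alpha> i j) v)))"

definition squarefree_system ::
    "nat \<Rightarrow> nat \<Rightarrow> (nat \<Rightarrow> nat \<Rightarrow> 'k::zero) \<Rightarrow> (nat \<Rightarrow> nat \<Rightarrow> 'n \<Rightarrow>\<^sub>0 nat) \<Rightarrow> bool" where
  "squarefree_system s l c \<alpha> \<longleftrightarrow>
     (\<exists>\<gamma> \<beta>. solves_E s l c \<alpha> \<gamma> \<beta> \<and>
        (\<forall>j\<in>{1..l}. \<forall>v. \<gamma> j v \<in> {0, 1}) \<and> (\<forall>i\<in>{1..s}. \<forall>v. \<beta> i v \<in> {0, 1}))"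

text \<open>The exponent of the least common multiple of the monomials with exponents in the finite
  nonempty set \<open>E\<close>.\<close>

definition lcm_exponent :: "('n::finite \<Rightarrow>\<^sub>0 nat) set \<Rightarrow> 'n \<Rightarrow>\<^sub>0 nat" where
  "lcm_exponent E = Abs_poly_mapping (\<lambda>v. Max ((\<lambda>a. Poly_Mapping.lookup a v) ` E))"

lemma lookup_lcm_exponent: "Poly_Mapping.lookup (lcm_exponent E) v = Max ((\<lambda>a. Poly_Mapping.lookup a v) ` E)"
  by (simp add: lcm_exponent_def)

text \<open>The ideal \<open>I\<^sub>i\<close>; the set \<open>J\<close> collects the column indices \<open>j\<^sub>1 < \<dots> < j\<^bsub>s-i+1\<^esub>\<close>.\<close>

definition lcm_ideal ::
    "nat \<Rightarrow> nat \<Rightarrow> (nat \<Rightarrow> nat \<Rightarrow> 'n::finite \<Rightarrow>\<^sub>0 nat) \<Rightarrow> nat \<Rightarrow> ('n, 'k::comm_ring_1) mpoly set" where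
  "lcm_ideal s l \<alpha> i =
     Idl\<^bsub>class_ring\<^esub>
       {Poly_Mapping.single (lcm_exponent (\<alpha> i ` J)) 1 | J. J \<subseteq> {1..l} \<and> card J = s - i + 1}"

definition module_codim ::
    "(('n::finite, 'k::comm_ring_1) mpoly, 'm, 'c) module_scheme \<Rightarrow> ereal" where
  "module_codim M = ereal (real CARD('n)) - module_dim class_ring M"

end

(* Each variable v either occurs with an exponent that does not depend on the column (if some
   beta_i contains v, then all gamma_j do) or with one that does not depend on the row. Hence a prime
   p contains ann M_A if and only if it contains some I_i: the maximal minors lie in ann M_A, and a
   monomial in p is divisible by a variable in p, so either some row vanishes modulo such a variable
   and p contains that I_i, or the variables in p kill a column in every maximal minor and p contains
   I_1. Conversely, if p contains I_i and no row vanishes, then at most s - i columns survive modulo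
   the column variables in p, so by Cramer's rule r times a nonzero minor free of these variables
   vanishes for r in ann M_A. Therefore codim ann M_A is the minimum of the codim I_i.
   All primes involved lie over monomial primes containing ann M_A, and for such ideals dimension
   and codimension add up to n as soon as no chain of primes in n variables is longer than n. The
   latter holds because n + 1 elements, one from each step of a longer chain, are algebraically
   dependent, while the lowest terms of a relation survive along the chain. *)

theory Submission
  imports Defs
begin

section \<open>Prime ideals\<close>

text \<open>Additive inverses are multiples by -1, so ideals of \<open>class_ring\<close> can be
  handled with the type class operations alone.\<close>

lemma ideal_class_ring_iff:
  fixes I :: "'a::comm_ring_1 set"
  shows "ideal I class_ring \<longleftrightarrow>
    0 \<in> I \<and> (\<forall>a\<in>I. \<forall>b\<in>I. a + b \<in> I) \<and> (\<forall>r. \<forall>a\<in>I. r * a \<in> I)"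
proof
  assume "ideal I class_ring"
  then interpret ideal I "class_ring :: 'a ring" .
  show "0 \<in> I \<and> (\<forall>a\<in>I. \<forall>b\<in>I. a + b \<in> I) \<and> (\<forall>r. \<forall>a\<in>I. r * a \<in> I)"
    using a_closed zero_closed I_l_closed by auto
next
  assume *: "0 \<in> I \<and> (\<forall>a\<in>I. \<forall>b\<in>I. a + b \<in> I) \<and> (\<forall>r. \<forall>a\<in>I. r * a \<in> I)"
  have "subgroup I (add_monoid (class_ring :: 'a ring))"
  proof
    fix x assume "x \<in> I"
    then have "(- 1) * x \<in> I" using * by blast
    moreover have "\<ominus>\<^bsub>class_ring\<^esub> x = - x" by (simp add: class_ring_simps)
    ultimately show "inv\<^bsub>add_monoid class_ring\<^esub> x \<in> I" unfolding a_inv_def by simp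
  qed (use * in auto)
  moreover have "\<forall>r. \<forall>a\<in>I. a * r \<in> I" using * by (metis mult.commute)
  ultimately show "ideal I class_ring"
    using * by (intro idealI class_ring.ring_axioms) auto
qed

lemma primeideal_class_ring_iff:
  fixes P :: "'a::comm_ring_1 set"
  shows "primeideal P class_ring \<longleftrightarrow>
    ideal P class_ring \<and> 1 \<notin> P \<and> (\<forall>a b. a * b \<in> P \<longrightarrow> a \<in> P \<or> b \<in> P)"
proof
  assume "primeideal P class_ring"
  then interpret primeideal P "class_ring :: 'a ring" .
  show "ideal P class_ring \<and> 1 \<notin> P \<and> (\<forall>a b. a * b \<in> P \<longrightarrow> a \<in> P \<or> b \<in> P)"
    using is_ideal one_imp_carrier I_notcarr I_prime by auto
next
  assume "ideal P class_ring \<and> 1 \<notin> P \<and> (\<forall>a b. a * b \<in> P \<longrightarrow> a \<in> P \<or> b \<in> P)"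
  then show "primeideal P class_ring"
    by (intro primeidealI class_cring.cring_axioms) auto
qed

lemma ideal_sum_mem:
  fixes I :: "'a::comm_ring_1 set"
  assumes "ideal I class_ring" "\<And>x. x \<in> S \<Longrightarrow> f x \<in> I"
  shows "sum f S \<in> I"
  using assms by (induction S rule: infinite_finite_induct) (auto simp: ideal_class_ring_iff)

lemma primeideal_power_mem:
  fixes P :: "'a::comm_ring_1 set"
  assumes "primeideal P class_ring" "x ^ k \<in> P"
  shows "x \<in> P"
  using assms by (induction k) (auto simp: primeideal_class_ring_iff)

lemma genideal_subset_iff:
  fixes S :: "'a::comm_ring_1 set"
  assumes "ideal P class_ring"
  shows "Idl\<^bsub>class_ring\<^esub> S \<subseteq> P \<longleftrightarrow> S \<subseteq> P"
  using ring.genideal_minimal[OF class_ring.ring_axioms assms, of S]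
    ring.genideal_self[OF class_ring.ring_axioms, of S] by auto

section \<open>Chains of prime ideals\<close>

text \<open>\<open>P m\<close> is dropped and \<open>Q 0\<close> takes its place, so the two may
  coincide; this is why the joined chain has length m + k and not m + k + 1.\<close>

lemma prime_chain_append:
  assumes "prime_chain R P m" "prime_chain R Q k" "P m \<subseteq> Q 0"
  shows "prime_chain R (\<lambda>i. if i < m then P i else Q (i - m)) (m + k)"
  unfolding prime_chain_def
proof (intro conjI allI impI)
  fix i assume "i \<le> m + k"
  then show "primeideal (if i < m then P i else Q (i - m)) R"
    using assms by (auto simp: prime_chain_def)
next
  fix i assume i: "i < m + k"
  consider "Suc i < m" | "Suc i = m" | "m \<le> i" by linarith
  then show "(if i < m then P i else Q (i - m)) \<subset> (if Suc i < m then P (Suc i) else Q (Suc i - m))"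
  proof cases
    case 2
    then have "P i \<subset> P m" using assms by (auto simp: prime_chain_def)
    then show ?thesis using 2 assms(3) by auto
  qed (use i assms in \<open>auto simp: prime_chain_def Suc_diff_le\<close>)
qed

lemma prime_height_upper:
  assumes "\<And>P m. prime_chain R P m \<Longrightarrow> P m = p \<Longrightarrow> ereal (real m) \<le> h"
  shows "prime_height R p \<le> h"
  unfolding prime_height_def using assms by (auto intro!: SUP_least)

lemma prime_height_lower:
  assumes "prime_chain R P m" "P m = p"
  shows "ereal (real m) \<le> prime_height R p"
  unfolding prime_height_def using assms by (auto intro!: SUP_upper)

text \<open>Appending the chain that consists of \<open>p\<close> alone replaces the top member
  \<open>P m\<close> by \<open>p\<close>.\<close>

lemma prime_height_mono_chain:
  assumes "prime_chain R P m" "P m \<subseteq> p" "primeideal p R"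
  shows "ereal (real m) \<le> prime_height R p"
proof -
  have "prime_chain R (\<lambda>_. p) 0" using assms(3) by (simp add: prime_chain_def)
  from prime_height_lower[OF prime_chain_append[OF assms(1) this assms(2)]] show ?thesis by simp
qed

section \<open>Primes of a quotient ring\<close>

lemma quot_carrierD:
  "X \<in> carrier (R Quot I) \<Longrightarrow> \<exists>r\<in>carrier R. X = I +>\<^bsub>R\<^esub> r"
  by (simp add: FactRing_def A_RCOSETS_def')

lemma zero_quot: "\<zero>\<^bsub>R Quot I\<^esub> = I"
  by (simp add: FactRing_def)

lemma primeideal_quot_vimage:
  assumes "cring R" "ideal I R" "primeideal Q (R Quot I)"
  shows "primeideal {r \<in> carrier R. I +>\<^bsub>R\<^esub> r \<in> Q} R" "I \<subseteq> {r \<in> carrier R. I +>\<^bsub>R\<^esub> r \<in> Q}"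
proof -
  interpret ideal I R by fact
  interpret Q: primeideal Q "R Quot I" by fact
  interpret h: ring_hom_ring R "R Quot I" "(+>\<^bsub>R\<^esub>) I" by (rule rcos_ring_hom_ring)
  show "primeideal {r \<in> carrier R. I +>\<^bsub>R\<^esub> r \<in> Q} R"
    by (rule h.primeideal_vimage) fact+
  \<comment> \<open>The zero of the quotient is the coset \<open>I\<close> itself.\<close>
  have "I \<in> Q" 
    using additive_subgroup.zero_closed[OF Q.additive_subgroup_axioms] unfolding zero_quot .
  then show "I \<subseteq> {r \<in> carrier R. I +>\<^bsub>R\<^esub> r \<in> Q}"
    using a_coset_join2[OF _ a_subgroup] Icarr by force
qed

lemma quot_vimage_strict_mono:
  assumes "ideal I R" "primeideal Q (R Quot I)" "primeideal Q' (R Quot I)" "Q \<subset> Q'"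
  shows "{r \<in> carrier R. I +>\<^bsub>R\<^esub> r \<in> Q} \<subset> {r \<in> carrier R. I +>\<^bsub>R\<^esub> r \<in> Q'}"
proof -
  interpret Q': primeideal Q' "R Quot I" by fact
  obtain X where X: "X \<in> Q'" "X \<notin> Q" using assms(4) by auto
  then have "X \<in> carrier (R Quot I)" using Q'.Icarr by auto
  from quot_carrierD[OF this] obtain r where r: "r \<in> carrier R" "X = I +>\<^bsub>R\<^esub> r" ..
  have "{r \<in> carrier R. I +>\<^bsub>R\<^esub> r \<in> Q} \<subseteq> {r \<in> carrier R. I +>\<^bsub>R\<^esub> r \<in> Q'}"
    using assms(4) by blast
  moreover have "r \<in> {r \<in> carrier R. I +>\<^bsub>R\<^esub> r \<in> Q'} - {r \<in> carrier R. I +>\<^bsub>R\<^esub> r \<in> Q}"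
    using r X by blast
  ultimately show ?thesis by blast
qed

text \<open>Since \<open>I\<close> lies in \<open>P\<close>, membership of a coset in the image can
  be tested on any representative; primality then lifts along representatives.\<close>

lemma primeideal_quot_image:
  assumes "cring R" "ideal I R" "primeideal P R" "I \<subseteq> P"
  shows "primeideal ((+>\<^bsub>R\<^esub>) I ` P) (R Quot I)"
    "\<And>r. r \<in> carrier R \<Longrightarrow> I +>\<^bsub>R\<^esub> r \<in> (+>\<^bsub>R\<^esub>) I ` P \<longleftrightarrow> r \<in> P"
proof -
  interpret ideal I R by fact
  interpret P: primeideal P R by fact
  interpret h: ring_hom_ring R "R Quot I" "(+>\<^bsub>R\<^esub>) I" by (rule rcos_ring_hom_ring)
  show mem: "I +>\<^bsub>R\<^esub> r \<in> (+>\<^bsub>R\<^esub>) I ` P \<longleftrightarrow> r \<in> P" if r: "r \<in> carrier R" for r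
  proof
    assume "I +>\<^bsub>R\<^esub> r \<in> (+>\<^bsub>R\<^esub>) I ` P"
    then obtain q where q: "q \<in> P" "I +>\<^bsub>R\<^esub> r = I +>\<^bsub>R\<^esub> q" by auto
    have "r \<in> I +>\<^bsub>R\<^esub> q" using a_rcos_self[OF r] q by simp
    then obtain i where "i \<in> I" "r = i \<oplus>\<^bsub>R\<^esub> q" by (auto simp: a_r_coset_def')
    then show "r \<in> P" using q assms(4) P.a_closed by auto
  qed auto
  have id: "ideal ((+>\<^bsub>R\<^esub>) I ` P) (R Quot I)"
    using ring_ideal_imp_quot_ideal[OF assms(2) P.is_ideal] .
  show "primeideal ((+>\<^bsub>R\<^esub>) I ` P) (R Quot I)"
  proof (rule primeidealI[OF id])
    show "cring (R Quot I)" using quotient_is_cring[OF assms(1)] .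
    have "\<one>\<^bsub>R\<^esub> \<notin> P" using P.one_imp_carrier P.I_notcarr by auto
    then have "I +>\<^bsub>R\<^esub> \<one>\<^bsub>R\<^esub> \<notin> (+>\<^bsub>R\<^esub>) I ` P" using mem[of "\<one>\<^bsub>R\<^esub>"] by blast
    moreover have "I +>\<^bsub>R\<^esub> \<one>\<^bsub>R\<^esub> \<in> carrier (R Quot I)" by (rule h.hom_closed) simp
    ultimately show "carrier (R Quot I) \<noteq> (+>\<^bsub>R\<^esub>) I ` P" by blast
  next
    fix X Y assume XY: "X \<in> carrier (R Quot I)" "Y \<in> carrier (R Quot I)"
      "X \<otimes>\<^bsub>R Quot I\<^esub> Y \<in> (+>\<^bsub>R\<^esub>) I ` P"
    obtain x where x: "x \<in> carrier R" "X = I +>\<^bsub>R\<^esub> x"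
      using quot_carrierD[OF XY(1)] by metis
    obtain y where y: "y \<in> carrier R" "Y = I +>\<^bsub>R\<^esub> y"
      using quot_carrierD[OF XY(2)] by metis
    note xy = x y
    have "I +>\<^bsub>R\<^esub> (x \<otimes>\<^bsub>R\<^esub> y) = X \<otimes>\<^bsub>R Quot I\<^esub> Y" using h.hom_mult xy by simp
    then have "I +>\<^bsub>R\<^esub> (x \<otimes>\<^bsub>R\<^esub> y) \<in> (+>\<^bsub>R\<^esub>) I ` P" using XY(3) by metis
    then have "x \<otimes>\<^bsub>R\<^esub> y \<in> P" using mem[of "x \<otimes>\<^bsub>R\<^esub> y"] xy by blast
    then show "X \<in> (+>\<^bsub>R\<^esub>) I ` P \<or> Y \<in> (+>\<^bsub>R\<^esub>) I ` P"
      using P.I_prime[of x y] xy by blast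
  qed
qed

text \<open>Chains of primes in the quotient correspond to chains of primes above \<open>I\<close>;
  asking this of \<open>P 0\<close> suffices, because the chain increases.\<close>

lemma krull_dim_quot:
  assumes "cring R" "ideal I R"
  shows "krull_dim (R Quot I) = (SUP m\<in>{m. \<exists>P. prime_chain R P m \<and> I \<subseteq> P 0}. ereal (real m))"
proof -
  have "(\<exists>Q. prime_chain (R Quot I) Q m) \<longleftrightarrow> (\<exists>P. prime_chain R P m \<and> I \<subseteq> P 0)" for m
  proof
    assume "\<exists>Q. prime_chain (R Quot I) Q m"
    then obtain Q where Q: "prime_chain (R Quot I) Q m" by blast
    define P where "P i = {r \<in> carrier R. I +>\<^bsub>R\<^esub> r \<in> Q i}" for i
    have "prime_chain R P m"
      using Q primeideal_quot_vimage(1)[OF assms] quot_vimage_strict_mono[OF assms(2)]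
      unfolding prime_chain_def P_def by simp
    moreover have "I \<subseteq> P 0"
      using Q primeideal_quot_vimage(2)[OF assms] unfolding prime_chain_def P_def by simp
    ultimately show "\<exists>P. prime_chain R P m \<and> I \<subseteq> P 0" by blast
  next
    assume "\<exists>P. prime_chain R P m \<and> I \<subseteq> P 0"
    then obtain P where P: "prime_chain R P m" "I \<subseteq> P 0" by blast
    have IP: "I \<subseteq> P i" if "i \<le> m" for i
      using that
    proof (induction i)
      case (Suc i)
      then show ?case using P(1) by (auto simp: prime_chain_def dest!: spec[of _ i])
    qed (use P in simp)
    have pr: "primeideal (P i) R" if "i \<le> m" for i using P(1) that by (simp add: prime_chain_def)
    note im = primeideal_quot_image[OF assms pr IP]
    have "(+>\<^bsub>R\<^esub>) I ` P i \<subset> (+>\<^bsub>R\<^esub>) I ` P (Suc i)" if i: "i < m" for i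
    proof -
      have PP: "P i \<subset> P (Suc i)" using P(1) i by (simp add: prime_chain_def)
      then obtain r where r: "r \<in> P (Suc i)" "r \<notin> P i" by auto
      interpret primeideal "P (Suc i)" R using pr i by simp
      have "r \<in> carrier R" using r Icarr by auto
      then have "I +>\<^bsub>R\<^esub> r \<notin> (+>\<^bsub>R\<^esub>) I ` P i" using im(2)[of i r] i r by simp
      then show ?thesis using PP r by blast
    qed
    then have "prime_chain (R Quot I) (\<lambda>i. (+>\<^bsub>R\<^esub>) I ` P i) m"
      using im(1) unfolding prime_chain_def by simp
    then show "\<exists>Q. prime_chain (R Quot I) Q m" by blast
  qed
  then show ?thesis unfolding krull_dim_def by simp
qed

section \<open>Monomials and monomial primes\<close>

definition mvar :: "'n \<Rightarrow> ('n, 'k::comm_ring_1) mpoly" where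
  "mvar v = Poly_Mapping.single (Poly_Mapping.single v 1) 1"

text \<open>The prime generated by the variables in \<open>T\<close>, given through its monomials so
  that membership is read off the support.\<close>

definition var_ideal :: "'n set \<Rightarrow> ('n, 'k::comm_ring_1) mpoly set" where
  "var_ideal T = {f. \<forall>m\<in>Poly_Mapping.keys f. \<exists>v\<in>T. Poly_Mapping.lookup m v \<noteq> 0}"

text \<open>The polynomial subring in the variables outside \<open>T\<close>, which embeds into the
  quotient by \<open>var_ideal T\<close>.\<close>

definition free_of :: "'n set \<Rightarrow> ('n, 'k::comm_ring_1) mpoly set" where
  "free_of T = {f. \<forall>m\<in>Poly_Mapping.keys f. \<forall>v\<in>T. Poly_Mapping.lookup m v = 0}"

lemma sum_single_lookup:
  fixes f :: "'a \<Rightarrow>\<^sub>0 'b::comm_monoid_add"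
  shows "(\<Sum>m\<in>Poly_Mapping.keys f. Poly_Mapping.single m (Poly_Mapping.lookup f m)) = f"
proof (rule poly_mapping_eqI)
  fix k
  have "Poly_Mapping.lookup (\<Sum>m\<in>Poly_Mapping.keys f. Poly_Mapping.single m (Poly_Mapping.lookup f m)) k
     = (\<Sum>m\<in>Poly_Mapping.keys f. if m = k then Poly_Mapping.lookup f k else 0)"
    by (auto simp: lookup_sum lookup_single when_def intro!: sum.cong)
  also have "\<dots> = Poly_Mapping.lookup f k"
    by (simp add: in_keys_iff)
  finally show "Poly_Mapping.lookup (\<Sum>m\<in>Poly_Mapping.keys f. Poly_Mapping.single m (Poly_Mapping.lookup f m)) k
     = Poly_Mapping.lookup f k" .
qed

lemma lookup_mult_keys:
  fixes f g :: "'a::comm_monoid_add \<Rightarrow>\<^sub>0 'b::comm_semiring_1"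
  shows "Poly_Mapping.lookup (f * g) k =
    (\<Sum>(a, b)\<in>Poly_Mapping.keys f \<times> Poly_Mapping.keys g.
       if k = a + b then Poly_Mapping.lookup f a * Poly_Mapping.lookup g b else 0)"
proof -
  have "f * g = (\<Sum>a\<in>Poly_Mapping.keys f. \<Sum>b\<in>Poly_Mapping.keys g.
      Poly_Mapping.single (a + b) (Poly_Mapping.lookup f a * Poly_Mapping.lookup g b))"
    unfolding mult_single[symmetric] sum_product[symmetric] sum_single_lookup ..
  then show ?thesis
    by (auto simp: lookup_sum lookup_single when_def sum.cartesian_product intro!: sum.cong)
qed

text \<open>Cut \<open>F\<close> and \<open>G\<close> down to the elements of least exponent in one variable after the other.\<close>

lemma unique_sum_exponents:
  fixes F G :: "('n \<Rightarrow>\<^sub>0 nat) set"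
  assumes "finite V" "finite F" "F \<noteq> {}" "finite G" "G \<noteq> {}"
  shows "\<exists>p\<in>F. \<exists>q\<in>G. \<forall>a\<in>F. \<forall>b\<in>G. a + b = p + q \<longrightarrow>
    (\<forall>v\<in>V. Poly_Mapping.lookup a v = Poly_Mapping.lookup p v \<and>
       Poly_Mapping.lookup b v = Poly_Mapping.lookup q v)"
  using assms
proof (induction V arbitrary: F G rule: finite_induct)
  case empty
  then show ?case by auto
next
  case (insert v V)
  define mF where "mF = Min ((\<lambda>a. Poly_Mapping.lookup a v) ` F)"
  define mG where "mG = Min ((\<lambda>a. Poly_Mapping.lookup a v) ` G)"
  define F' where "F' = {a\<in>F. Poly_Mapping.lookup a v = mF}"
  define G' where "G' = {a\<in>G. Poly_Mapping.lookup a v = mG}"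
  have mF: "mF \<le> Poly_Mapping.lookup a v" if "a \<in> F" for a
    using that insert.prems by (simp add: mF_def)
  have mG: "mG \<le> Poly_Mapping.lookup a v" if "a \<in> G" for a
    using that insert.prems by (simp add: mG_def)
  have "mF \<in> (\<lambda>a. Poly_Mapping.lookup a v) ` F" "mG \<in> (\<lambda>a. Poly_Mapping.lookup a v) ` G"
    unfolding mF_def mG_def using insert.prems by (auto intro!: Min_in simp del: Min_in)
  then have "F' \<noteq> {}" "G' \<noteq> {}" by (auto simp: F'_def G'_def)
  moreover have "finite F'" "finite G'" using insert.prems by (auto simp: F'_def G'_def)
  ultimately obtain p q where pq: "p \<in> F'" "q \<in> G'"
    and u: "\<And>a b. a \<in> F' \<Longrightarrow> b \<in> G' \<Longrightarrow> a + b = p + q \<Longrightarrow>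
      (\<forall>v\<in>V. Poly_Mapping.lookup a v = Poly_Mapping.lookup p v \<and>
         Poly_Mapping.lookup b v = Poly_Mapping.lookup q v)"
    using insert.IH[of F' G'] by metis
  have main: "\<forall>w\<in>insert v V. Poly_Mapping.lookup a w = Poly_Mapping.lookup p w \<and>
         Poly_Mapping.lookup b w = Poly_Mapping.lookup q w"
    if ab: "a \<in> F" "b \<in> G" "a + b = p + q" for a b
  proof -
    \<comment> \<open>Both exponents of \<open>v\<close> are at least the minima and add up to their
      sum, so both are minimal.\<close>
    have "Poly_Mapping.lookup a v + Poly_Mapping.lookup b v = mF + mG"
      using arg_cong[OF ab(3), of "\<lambda>m. Poly_Mapping.lookup m v"] pq
      by (simp add: lookup_add F'_def G'_def)
    then have "Poly_Mapping.lookup a v = mF" "Poly_Mapping.lookup b v = mG"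
      using mF[OF ab(1)] mG[OF ab(2)] by linarith+
    then show ?thesis using u[of a b] ab pq by (auto simp: F'_def G'_def)
  qed
  have "p \<in> F" "q \<in> G" using pq by (auto simp: F'_def G'_def)
  then show ?case using main by blast
qed

lemma ideal_var_ideal:
  "ideal (var_ideal T :: ('n, 'k::comm_ring_1) mpoly set) class_ring"
  unfolding ideal_class_ring_iff
proof (intro conjI ballI allI)
  show "0 \<in> (var_ideal T :: ('n, 'k) mpoly set)" by (simp add: var_ideal_def)
next
  fix a b :: "('n, 'k) mpoly" assume "a \<in> var_ideal T" "b \<in> var_ideal T"
  then show "a + b \<in> var_ideal T"
    using Poly_Mapping.keys_add[of a b] unfolding var_ideal_def by blast
next
  fix r a :: "('n, 'k) mpoly" assume a: "a \<in> var_ideal T"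
  have "\<exists>v\<in>T. Poly_Mapping.lookup m v \<noteq> 0" if m: "m \<in> Poly_Mapping.keys (r * a)" for m
  proof -
    obtain x y where "m = x + y" "y \<in> Poly_Mapping.keys a" using keys_mult[of r a] m by blast
    then show ?thesis using a by (auto simp: var_ideal_def lookup_add)
  qed
  then show "r * a \<in> var_ideal T" by (simp add: var_ideal_def)
qed

text \<open>If both factors have terms without variables of \<open>T\<close>, a sum p + q of two
  such exponents that arises in only one way keeps a nonzero coefficient in the product, and no
  variable of \<open>T\<close> divides it.\<close>

lemma primeideal_var_ideal:
  "primeideal (var_ideal T :: ('n::finite, 'k::field) mpoly set) class_ring"
  unfolding primeideal_class_ring_iff
proof (intro conjI allI impI ideal_var_ideal)
  show "1 \<notin> (var_ideal T :: ('n, 'k) mpoly set)" by (simp add: var_ideal_def)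
next
  fix f g :: "('n, 'k) mpoly" assume fg: "f * g \<in> var_ideal T"
  show "f \<in> var_ideal T \<or> g \<in> var_ideal T"
  proof (rule ccontr)
    assume n: "\<not> (f \<in> var_ideal T \<or> g \<in> var_ideal T)"
    define F where "F = {m\<in>Poly_Mapping.keys f. \<forall>v\<in>T. Poly_Mapping.lookup m v = 0}"
    define G where "G = {m\<in>Poly_Mapping.keys g. \<forall>v\<in>T. Poly_Mapping.lookup m v = 0}"
    have fin: "finite F" "F \<noteq> {}" "finite G" "G \<noteq> {}"
      using n unfolding F_def G_def var_ideal_def by auto
    from unique_sum_exponents[OF finite[of "UNIV :: 'n set"] fin] obtain p q where pq: "p \<in> F" "q \<in> G"
      and u': "\<forall>a\<in>F. \<forall>b\<in>G. a + b = p + q \<longrightarrow>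
        (\<forall>v\<in>UNIV. Poly_Mapping.lookup a v = Poly_Mapping.lookup p v \<and>
           Poly_Mapping.lookup b v = Poly_Mapping.lookup q v)"
      by (elim bexE)
    have u: "a = p \<and> b = q" if "a \<in> F" "b \<in> G" "a + b = p + q" for a b
    proof -
      have "\<forall>v. Poly_Mapping.lookup a v = Poly_Mapping.lookup p v \<and>
           Poly_Mapping.lookup b v = Poly_Mapping.lookup q v"
        using u' that by blast
      then show ?thesis by (simp add: poly_mapping_eq_iff fun_eq_iff)
    qed
    have T0: "\<forall>v\<in>T. Poly_Mapping.lookup (p + q) v = 0"
      using pq by (auto simp: F_def G_def lookup_add)
    \<comment> \<open>Exponents cannot cancel: p + q is 0 on \<open>T\<close>, so \<open>a\<close>
      and \<open>b\<close> are as well and thus lie in \<open>F\<close> and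
      \<open>G\<close>.\<close>
    have *: "p + q = a + b \<longleftrightarrow> a = p \<and> b = q"
      if "a \<in> Poly_Mapping.keys f" "b \<in> Poly_Mapping.keys g" for a b
    proof
      assume eq: "p + q = a + b"
      then have "\<forall>v\<in>T. Poly_Mapping.lookup a v + Poly_Mapping.lookup b v = 0"
        using T0 by (simp add: lookup_add)
      then show "a = p \<and> b = q" using u[of a b] eq that by (simp add: F_def G_def)
    qed auto
    have "Poly_Mapping.lookup (f * g) (p + q) = (\<Sum>x\<in>Poly_Mapping.keys f \<times> Poly_Mapping.keys g.
        if x = (p, q) then Poly_Mapping.lookup f p * Poly_Mapping.lookup g q else 0)"
      unfolding lookup_mult_keys using * by (intro sum.cong) (auto split: prod.splits)
    also have "\<dots> = Poly_Mapping.lookup f p * Poly_Mapping.lookup g q"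
      using pq by (simp add: F_def G_def)
    finally have "p + q \<in> Poly_Mapping.keys (f * g)"
      using pq by (auto simp: F_def G_def in_keys_iff)
    then show False using fg T0 by (auto simp: var_ideal_def)
  qed
qed

lemma mvar_mem_var_ideal_iff: "(mvar v :: ('n, 'k::comm_ring_1) mpoly) \<in> var_ideal T \<longleftrightarrow> v \<in> T"
  by (auto simp: mvar_def var_ideal_def lookup_single when_def)

lemma single_mem_var_ideal:
  "v \<in> T \<Longrightarrow> Poly_Mapping.lookup e v \<noteq> 0 \<Longrightarrow> Poly_Mapping.single e d \<in> var_ideal T"
  by (auto simp: var_ideal_def)

lemma single_factor_mvar:
  fixes d :: "'k::comm_ring_1"
  assumes "Poly_Mapping.lookup e v \<noteq> 0"
  shows "\<exists>e'. e = e' + Poly_Mapping.single v 1 \<and>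
    Poly_Mapping.single e d = Poly_Mapping.single e' d * mvar v"
proof -
  define e' where "e' = e - Poly_Mapping.single v 1"
  have "e = e' + Poly_Mapping.single v 1"
    using assms by (intro poly_mapping_eqI) (auto simp: e'_def lookup_add lookup_minus lookup_single when_def)
  moreover have "Poly_Mapping.single (e' + Poly_Mapping.single v 1) d = Poly_Mapping.single e' d * mvar v"
    by (simp add: mult_single mvar_def)
  ultimately show ?thesis by metis
qed

lemma single_mem_ideal:
  assumes "ideal P (class_ring :: ('n, 'k::comm_ring_1) mpoly ring)" "mvar v \<in> P" "Poly_Mapping.lookup e v \<noteq> 0"
  shows "Poly_Mapping.single e d \<in> P"
  using single_factor_mvar[OF assms(3), of d] assms(1,2) unfolding ideal_class_ring_iff by metis

text \<open>Induction on the total degree: either the variable split off or the remaining monomial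
  is in \<open>P\<close>, and exponent 0 is excluded because a nonzero constant is a unit.\<close>

lemma single_mem_primeideal:
  fixes P :: "('n::finite, 'k::field) mpoly set"
  assumes "primeideal P class_ring" "Poly_Mapping.single e d \<in> P" "d \<noteq> 0"
  shows "\<exists>v. Poly_Mapping.lookup e v \<noteq> 0 \<and> mvar v \<in> P"
  using assms(2)
proof (induction "\<Sum>v\<in>UNIV. Poly_Mapping.lookup e v" arbitrary: e rule: less_induct)
  case less
  have P: "1 \<notin> P" "\<And>a b. a * b \<in> P \<Longrightarrow> a \<in> P \<or> b \<in> P" "\<And>r a. a \<in> P \<Longrightarrow> r * a \<in> P"
    using assms(1) by (auto simp: primeideal_class_ring_iff ideal_class_ring_iff)
  show ?case
  proof (cases "e = 0")
    case True
    have "Poly_Mapping.single 0 (inverse d) * Poly_Mapping.single e d \<in> P"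
      using P(3) less.prems by blast
    then show ?thesis using P(1) True assms(3) by (simp add: mult_single)
  next
    case False
    then obtain v where v: "Poly_Mapping.lookup e v \<noteq> 0"
      by (metis lookup_zero poly_mapping_eqI)
    from single_factor_mvar[OF v, of d] obtain e' where e': "e = e' + Poly_Mapping.single v 1"
      "Poly_Mapping.single e d = Poly_Mapping.single e' d * mvar v" by blast
    have "(\<Sum>v\<in>UNIV. Poly_Mapping.lookup e v) = (\<Sum>v\<in>UNIV. Poly_Mapping.lookup e' v) + 1"
      by (simp add: e'(1) lookup_add sum.distrib lookup_single when_def)
    then have small: "(\<Sum>v\<in>UNIV. Poly_Mapping.lookup e' v) < (\<Sum>v\<in>UNIV. Poly_Mapping.lookup e v)"
      by simp
    have "Poly_Mapping.single e' d \<in> P \<or> mvar v \<in> P"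
      using P(2) less.prems unfolding e'(2) .
    then show ?thesis
    proof
      assume "Poly_Mapping.single e' d \<in> P"
      from less.hyps[OF small this] obtain w where w: "Poly_Mapping.lookup e' w \<noteq> 0" "mvar w \<in> P"
        by blast
      then show ?thesis unfolding e'(1) lookup_add by (intro exI[of _ w]) simp
    qed (use v in blast)
  qed
qed

text \<open>Each term of an element of \<open>var_ideal T\<close> is a multiple of a variable in
  \<open>T\<close>.\<close>

lemma var_ideal_subset:
  fixes P :: "('n, 'k::comm_ring_1) mpoly set"
  assumes "ideal P class_ring" "\<And>v. v \<in> T \<Longrightarrow> mvar v \<in> P"
  shows "var_ideal T \<subseteq> P"
proof
  fix f :: "('n, 'k) mpoly" assume f: "f \<in> var_ideal T"
  have "(\<Sum>m\<in>Poly_Mapping.keys f. Poly_Mapping.single m (Poly_Mapping.lookup f m)) \<in> P"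
  proof (rule ideal_sum_mem[OF assms(1)])
    fix m assume "m \<in> Poly_Mapping.keys f"
    then obtain v where "v \<in> T" "Poly_Mapping.lookup m v \<noteq> 0" using f unfolding var_ideal_def by blast
    then show "Poly_Mapping.single m (Poly_Mapping.lookup f m) \<in> P"
      using single_mem_ideal[OF assms(1) assms(2)] by blast
  qed
  then show "f \<in> P" by (simp add: sum_single_lookup)
qed

lemma var_ideal_mono_iff:
  "(var_ideal T :: ('n, 'k::comm_ring_1) mpoly set) \<subseteq> var_ideal U \<longleftrightarrow> T \<subseteq> U"
proof
  assume "(var_ideal T :: ('n, 'k) mpoly set) \<subseteq> var_ideal U"
  then have "(mvar v :: ('n, 'k) mpoly) \<in> var_ideal U" if "v \<in> T" for v
    using that mvar_mem_var_ideal_iff subsetD by metis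
  then show "T \<subseteq> U" using mvar_mem_var_ideal_iff by (metis subsetI)
next
  assume TU: "T \<subseteq> U"
  show "(var_ideal T :: ('n, 'k) mpoly set) \<subseteq> var_ideal U"
  proof
    fix f :: "('n, 'k) mpoly" assume "f \<in> var_ideal T"
    then have "\<exists>v\<in>U. Poly_Mapping.lookup m v \<noteq> 0" if "m \<in> Poly_Mapping.keys f" for m
      using TU that by (auto simp: var_ideal_def)
    then show "f \<in> var_ideal U" by (simp add: var_ideal_def)
  qed
qed

section \<open>Polynomials free of given variables; chains of monomial primes\<close>

lemma free_of_closed:
  fixes f g :: "('n, 'k::comm_ring_1) mpoly"
  shows "0 \<in> (free_of T :: ('n, 'k) mpoly set)" "1 \<in> (free_of T :: ('n, 'k) mpoly set)"
    and "f \<in> free_of T \<Longrightarrow> - f \<in> free_of T"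
    and "f \<in> free_of T \<Longrightarrow> g \<in> free_of T \<Longrightarrow> f + g \<in> free_of T"
    and "f \<in> free_of T \<Longrightarrow> g \<in> free_of T \<Longrightarrow> f * g \<in> free_of T"
proof -
  show "f + g \<in> free_of T" if "f \<in> free_of T" "g \<in> free_of T"
    using Poly_Mapping.keys_add[of f g] that unfolding free_of_def by blast
  show "f * g \<in> free_of T" if "f \<in> free_of T" "g \<in> free_of T"
  proof -
    have "\<forall>v\<in>T. Poly_Mapping.lookup m v = 0" if m: "m \<in> Poly_Mapping.keys (f * g)" for m
    proof -
      obtain x y where "m = x + y" "x \<in> Poly_Mapping.keys f" "y \<in> Poly_Mapping.keys g"
        using keys_mult[of f g] m by blast
      then show ?thesis using \<open>f \<in> free_of T\<close> \<open>g \<in> free_of T\<close>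
        by (simp add: free_of_def lookup_add)
    qed
    then show ?thesis by (simp add: free_of_def)
  qed
qed (auto simp: free_of_def)

lemma single_mem_free_of:
  "(\<And>v. v \<in> T \<Longrightarrow> Poly_Mapping.lookup e v = 0) \<Longrightarrow> Poly_Mapping.single e d \<in> free_of T"
  by (auto simp: free_of_def)

lemma free_of_var_ideal: "f \<in> free_of T \<Longrightarrow> f \<in> var_ideal T \<Longrightarrow> f = 0"
proof -
  assume "f \<in> free_of T" "f \<in> var_ideal T"
  then have "Poly_Mapping.keys f = {}" by (auto simp: free_of_def var_ideal_def)
  then show "f = 0" by simp
qed

text \<open>The determinant is a signed sum of products of entries and \<open>free_of T\<close> is a
  subring; \<open>det\<close> of a non-square matrix is 0.\<close>

lemma det_mem_free_of:
  fixes B :: "('n, 'k::comm_ring_1) mpoly mat"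
  assumes "\<And>i j. i < dim_row B \<Longrightarrow> j < dim_col B \<Longrightarrow> B $$ (i, j) \<in> free_of T"
  shows "det B \<in> free_of T"
proof (cases "dim_row B = dim_col B")
  case True
  then have B: "B \<in> carrier_mat (dim_row B) (dim_row B)" by auto
  have sum: "sum h S \<in> free_of T" if "\<And>x. x \<in> S \<Longrightarrow> h x \<in> free_of T"
    for h :: "(nat \<Rightarrow> nat) \<Rightarrow> ('n, 'k) mpoly" and S
    using that by (induction S rule: infinite_finite_induct) (auto intro: free_of_closed)
  have prod: "prod h S \<in> free_of T" if "\<And>x. x \<in> S \<Longrightarrow> h x \<in> free_of T"
    for h :: "nat \<Rightarrow> ('n, 'k) mpoly" and S
    using that by (induction S rule: infinite_finite_induct) (auto intro: free_of_closed)
  have "signof p * (\<Prod>i = 0..<dim_row B. B $$ (i, p i)) \<in> free_of T"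
    if p: "p permutes {0..<dim_row B}" for p
  proof (intro free_of_closed(5) prod)
    show "(signof p :: ('n, 'k) mpoly) \<in> free_of T"
      by (auto simp: sign_def intro: free_of_closed)
    show "B $$ (i, p i) \<in> free_of T" if "i \<in> {0..<dim_row B}" for i
      using assms[of i "p i"] that permutes_in_image[OF p, of i] True by auto
  qed
  then show ?thesis unfolding det_def'[OF B] by (intro sum) auto
qed (simp add: det_def free_of_closed)

text \<open>Adjoining the variables of \<open>U - T\<close> one at a time gives strict
  steps.\<close>

lemma prime_chain_var_ideal:
  fixes T U :: "'n::finite set"
  assumes "T \<subseteq> U"
  shows "\<exists>P. prime_chain class_ring P (card (U - T)) \<and>
    P 0 = (var_ideal T :: ('n, 'k::field) mpoly set) \<and> P (card (U - T)) = var_ideal U"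
  using finite[of "U - T"] assms
proof (induction "U - T" arbitrary: T rule: finite_induct)
  case empty
  then have "U = T" by auto
  then show ?case
    by (intro exI[of _ "\<lambda>_. var_ideal T"]) (simp add: prime_chain_def primeideal_var_ideal)
next
  case (insert x F)
  have "card (U - T) = card (insert x F)" unfolding insert.hyps(4) ..
  also have "\<dots> = Suc (card F)" using insert.hyps(1,2) by simp
  finally have UT: "card (U - T) = Suc (card F)" "U - insert x T = F" using insert.hyps by auto
  have "insert x T \<subseteq> U" using insert.hyps(4) insert.prems by blast
  then obtain P where P: "prime_chain class_ring P (card F)"
      "P 0 = (var_ideal (insert x T) :: ('n, 'k) mpoly set)" "P (card F) = var_ideal U"
    using insert.hyps(3)[of "insert x T"] UT(2) by auto
  have xT: "x \<notin> T" using insert.hyps by auto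
  have "prime_chain class_ring
      (\<lambda>i. if i = 0 then var_ideal T else var_ideal (insert x T) :: ('n, 'k) mpoly set) 1"
    using xT by (auto simp: prime_chain_def primeideal_var_ideal psubset_eq var_ideal_mono_iff
        dest!: equalityD2)
  from prime_chain_append[OF this P(1)] P(2)
  have "prime_chain class_ring (\<lambda>i. if i < 1 then
      (if i = 0 then var_ideal T else var_ideal (insert x T)) else P (i - 1)) (1 + card F)" by simp
  then show ?case
    using P UT(1) by (intro exI[of _ "\<lambda>i. if i < 1 then
      (if i = 0 then var_ideal T else var_ideal (insert x T)) else P (i - 1)"]) auto
qed

section \<open>The dimension of a polynomial ring\<close>

text \<open>Gaussian elimination with unknowns indexed by \<open>U\<close> and equations by
  \<open>V\<close>: an equation that involves some unknown is solved for it and substituted into the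
  others.\<close>

lemma homogeneous_system_nontrivial:
  fixes a :: "'u \<Rightarrow> 'v \<Rightarrow> 'k::field"
  assumes "finite V" "finite U" "card V < card U"
  shows "\<exists>c. (\<exists>u\<in>U. c u \<noteq> 0) \<and> (\<forall>v\<in>V. (\<Sum>u\<in>U. c u * a u v) = 0)"
  using assms
proof (induction V arbitrary: U a rule: finite_induct)
  case empty
  then obtain u where "u \<in> U" by fastforce
  then show ?case by (intro exI[of _ "\<lambda>_. 1"]) auto
next
  case (insert v V)
  show ?case
  proof (cases "\<forall>u\<in>U. a u v = 0")
    case True
    have "card V < card U" using insert.prems insert.hyps by simp
    from insert.IH[OF insert.prems(1) this, of a] obtain c where
      "\<exists>u\<in>U. c u \<noteq> 0" "\<forall>v\<in>V. (\<Sum>u\<in>U. c u * a u v) = 0" by blast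
    then show ?thesis using True by (intro exI[of _ c]) simp
  next
    case False
    then obtain u0 where u0: "u0 \<in> U" "a u0 v \<noteq> 0" by blast
    define U' where "U' = U - {u0}"
    have U': "U = insert u0 U'" "u0 \<notin> U'" "finite U'" using u0 insert.prems by (auto simp: U'_def)
    have "card V < card U'" using insert.prems insert.hyps U' by simp
    \<comment> \<open>These are the coefficients left after equation \<open>v\<close> has been used
      to eliminate the unknown at \<open>u0\<close>.\<close>
    from insert.IH[OF U'(3) this, of "\<lambda>u w. a u w - a u v / a u0 v * a u0 w"] obtain c where
      c: "\<exists>u\<in>U'. c u \<noteq> 0" "\<forall>w\<in>V. (\<Sum>u\<in>U'. c u * (a u w - a u v / a u0 v * a u0 w)) = 0" by blast
    define s where "s = (\<Sum>u\<in>U'. c u * a u v)"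
    \<comment> \<open>The value at \<open>u0\<close> is the one forced by equation
      \<open>v\<close>.\<close>
    define c' where "c' u = (if u = u0 then - s / a u0 v else c u)" for u
    have sum': "(\<Sum>u\<in>U. c' u * a u w) = - s / a u0 v * a u0 w + (\<Sum>u\<in>U'. c u * a u w)" for w
    proof -
      have "(\<Sum>u\<in>U'. c' u * a u w) = (\<Sum>u\<in>U'. c u * a u w)"
        using U' by (intro sum.cong) (auto simp: c'_def)
      then show ?thesis using U' by (simp add: c'_def)
    qed
    have "(\<Sum>u\<in>U. c' u * a u w) = 0" if "w \<in> V" for w
    proof -
      have "0 = (\<Sum>u\<in>U'. c u * a u w - a u0 w / a u0 v * (c u * a u v))"
        using c(2) that by (simp add: algebra_simps)
      also have "\<dots> = (\<Sum>u\<in>U'. c u * a u w) - a u0 w / a u0 v * s"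
        by (simp add: s_def sum_subtractf sum_distrib_left)
      finally show ?thesis by (simp add: sum')
    qed
    moreover have "(\<Sum>u\<in>U. c' u * a u v) = 0" using u0 by (simp add: sum' s_def)
    moreover have "\<exists>u\<in>U. c' u \<noteq> 0" using c(1) U' by (auto simp: c'_def)
    ultimately show ?thesis by blast
  qed
qed

text \<open>The bound applies to each variable separately, so the admissible exponents form a box
  with (B + 1)^n elements.\<close>

definition deg_le :: "nat \<Rightarrow> ('n, 'k::comm_ring_1) mpoly \<Rightarrow> bool" where
  "deg_le B f \<longleftrightarrow> (\<forall>m\<in>Poly_Mapping.keys f. \<forall>v. Poly_Mapping.lookup m v \<le> B)"

lemma deg_le_mult: "deg_le B f \<Longrightarrow> deg_le C g \<Longrightarrow> deg_le (B + C) (f * g)"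
proof -
  assume fg: "deg_le B f" "deg_le C g"
  have "Poly_Mapping.lookup m v \<le> B + C" if m: "m \<in> Poly_Mapping.keys (f * g)" for m v
  proof -
    obtain x y where "m = x + y" "x \<in> Poly_Mapping.keys f" "y \<in> Poly_Mapping.keys g"
      using keys_mult[of f g] m by blast
    then show ?thesis using fg by (simp add: deg_le_def lookup_add add_mono)
  qed
  then show ?thesis by (simp add: deg_le_def)
qed

lemma deg_le_mono: "deg_le B f \<Longrightarrow> B \<le> C \<Longrightarrow> deg_le C f"
  unfolding deg_le_def using le_trans by blast

lemma deg_le_power: "deg_le B f \<Longrightarrow> deg_le (k * B) (f ^ k)"
proof (induction k)
  case 0
  show ?case by (simp add: deg_le_def)
next
  case (Suc k)
  then show ?case using deg_le_mult[of B f "k * B" "f ^ k"] by simp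
qed

lemma exists_deg_le:
  fixes f :: "('n::finite, 'k::comm_ring_1) mpoly"
  shows "\<exists>B. deg_le B f"
proof -
  define S where "S = (\<lambda>(m, v). Poly_Mapping.lookup m v) ` (Poly_Mapping.keys f \<times> (UNIV :: 'n set))"
  have "finite S" by (simp add: S_def)
  moreover have "Poly_Mapping.lookup m v \<in> S" if "m \<in> Poly_Mapping.keys f" for m v
    using that unfolding S_def by force
  ultimately show ?thesis unfolding deg_le_def by (intro exI[of _ "Max S"]) simp
qed

lemma finite_bounded_exponents:
  fixes B :: nat
  defines "V \<equiv> {m :: 'n::finite \<Rightarrow>\<^sub>0 nat. \<forall>v. Poly_Mapping.lookup m v \<le> B}"
  shows "finite V" "card V \<le> (B + 1) ^ CARD('n)"
proof -
  have inj: "inj_on Poly_Mapping.lookup V" by (auto simp: inj_on_def)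
  have sub: "Poly_Mapping.lookup ` V \<subseteq> (UNIV :: 'n set) \<rightarrow>\<^sub>E {..B}" by (auto simp: V_def)
  have fin: "finite ((UNIV :: 'n set) \<rightarrow>\<^sub>E {..B})" by (intro finite_PiE) auto
  show "finite V" using inj sub fin finite_imageD finite_subset by blast
  have "card V \<le> card ((UNIV :: 'n set) \<rightarrow>\<^sub>E {..B})"
    using card_inj_on_le[OF inj sub fin] .
  then show "card V \<le> (B + 1) ^ CARD('n)" by (simp add: card_PiE)
qed

text \<open>Lists allow the factors to be peeled off one by one along a chain of primes.\<close>

definition power_product :: "'a::comm_monoid_mult list \<Rightarrow> nat list \<Rightarrow> 'a" where
  "power_product fs es = prod_list (map2 (^) fs es)"

lemma power_product_simps [simp]:
  "power_product [] [] = 1"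
  "power_product (f # fs) (e # es) = f ^ e * power_product fs es"
  by (simp_all add: power_product_def)

lemma deg_le_power_product:
  assumes "length es = length fs" "\<And>f. f \<in> set fs \<Longrightarrow> deg_le D f" "\<And>e. e \<in> set es \<Longrightarrow> e \<le> N"
  shows "deg_le (length fs * (N * D)) (power_product fs es)"
  using assms
proof (induction es fs rule: list_induct2)
  case Nil
  show ?case by (simp add: deg_le_def)
next
  case (Cons e es f fs)
  have "deg_le (e * D) (f ^ e)" using Cons by (intro deg_le_power) auto
  moreover have "e * D \<le> N * D" using Cons.prems(2) by simp
  ultimately have "deg_le (N * D) (f ^ e)" by (rule deg_le_mono)
  then show ?case using Cons deg_le_mult[of "N * D" "f ^ e"] by simp
qed

text \<open>Counting: the products of degree at most \<open>N\<close> in each of the given polynomials outnumber, for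
  large \<open>N\<close>, the monomials in which they can be expanded.\<close>

lemma algebraic_dependence:
  fixes fs :: "('n::finite, 'k::field) mpoly list"
  assumes "CARD('n) < length fs"
  shows "\<exists>E c. finite E \<and> E \<noteq> {} \<and> (\<forall>es\<in>E. length es = length fs \<and> c es \<noteq> 0) \<and>
    (\<Sum>es\<in>E. Poly_Mapping.single 0 (c es) * power_product fs es) = 0"
proof -
  have "\<exists>D. \<forall>f\<in>set fs. deg_le D f"
  proof (induction fs)
    case (Cons f fs)
    then obtain D where D: "\<forall>f\<in>set fs. deg_le D f" by blast
    obtain B where "deg_le B f" using exists_deg_le by blast
    then show ?case using D by (intro exI[of _ "max D B"]) (auto intro: deg_le_mono)
  qed simp
  then obtain D where D: "\<And>f. f \<in> set fs \<Longrightarrow> deg_le D f" by blast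
  define n where "n = CARD('n)"
  \<comment> \<open>B + 1 is at most (N + 1) K, and the choice N = K^n turns ((N + 1) K)^n into (N +
    1)^n N, which is less than (N + 1)^(n+1).\<close>
  define K where "K = length fs * D + 1"
  define N where "N = K ^ n"
  define B where "B = length fs * (N * D)"
  define U where "U = {es. set es \<subseteq> {..N} \<and> length es = length fs}"
  define V where "V = {m :: 'n \<Rightarrow>\<^sub>0 nat. \<forall>v. Poly_Mapping.lookup m v \<le> B}"
  have finV: "finite V" using finite_bounded_exponents(1) by (simp add: V_def)
  have "card V \<le> (B + 1) ^ n" using finite_bounded_exponents(2) by (simp add: V_def n_def)
  also have "(B + 1) ^ n \<le> ((N + 1) * K) ^ n"
    by (intro power_mono) (auto simp: B_def K_def algebra_simps)
  also have "\<dots> = (N + 1) ^ n * N" unfolding power_mult_distrib N_def[symmetric] ..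
  also have "\<dots> < (N + 1) ^ n * (N + 1)" by simp
  also have "\<dots> = (N + 1) ^ Suc n" by simp
  also have "\<dots> \<le> (N + 1) ^ length fs" using assms by (intro power_increasing) (auto simp: n_def)
  also have "\<dots> = card U" by (simp add: U_def card_lists_length_eq)
  finally have less: "card V < card U" .
  have finU: "finite U" by (simp add: U_def finite_lists_length_eq)
  from homogeneous_system_nontrivial[OF finV finU less, of "\<lambda>es. Poly_Mapping.lookup (power_product fs es)"]
  obtain c where c: "\<exists>es\<in>U. c es \<noteq> 0"
    "\<forall>m\<in>V. (\<Sum>es\<in>U. c es * Poly_Mapping.lookup (power_product fs es) m) = 0" by blast
  have lookup_C: "Poly_Mapping.lookup (Poly_Mapping.single 0 d * f) m = d * Poly_Mapping.lookup f m"
    for d and f :: "('n, 'k) mpoly" and m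
    by (simp add: mult_map_scale_conv_mult[symmetric] Poly_Mapping.map.rep_eq when_def)
  have zero: "(\<Sum>es\<in>U. Poly_Mapping.single 0 (c es) * power_product fs es) = 0"
  proof (rule poly_mapping_eqI)
    fix m
    have "(\<Sum>es\<in>U. c es * Poly_Mapping.lookup (power_product fs es) m) = 0"
    proof (cases "m \<in> V")
      case False
      \<comment> \<open>Outside \<open>V\<close> some exponent exceeds the degree bound
        \<open>B\<close> of all products.\<close>
      have "Poly_Mapping.lookup (power_product fs es) m = 0" if es: "es \<in> U" for es
      proof -
        have "deg_le B (power_product fs es)"
          unfolding B_def using es D by (intro deg_le_power_product) (auto simp: U_def)
        then have "m \<notin> Poly_Mapping.keys (power_product fs es)"
          using False by (auto simp: deg_le_def V_def)
        then show ?thesis by (simp add: in_keys_iff)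
      qed
      then show ?thesis by simp
    qed (use c in simp)
    then show "Poly_Mapping.lookup (\<Sum>es\<in>U. Poly_Mapping.single 0 (c es) * power_product fs es) m
        = Poly_Mapping.lookup 0 m"
      by (simp add: lookup_sum lookup_C)
  qed
  define E where "E = {es\<in>U. c es \<noteq> 0}"
  have "(\<Sum>es\<in>E. Poly_Mapping.single 0 (c es) * power_product fs es) =
      (\<Sum>es\<in>U. Poly_Mapping.single 0 (c es) * power_product fs es)"
    using finU by (intro sum.mono_neutral_left) (auto simp: E_def)
  moreover have "finite E" using finU by (simp add: E_def)
  ultimately show ?thesis
    using zero c(1) by (intro exI[of _ E] exI[of _ c]) (auto simp: E_def U_def)
qed

text \<open>Peel off \<open>f\<close> to its lowest power \<open>a\<close>: the sum is \<open>f ^ a * (S0 + f * S1)\<close>, and modulo the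
  next prime, which contains \<open>f\<close>, only the relation \<open>S0\<close> among the remaining elements is left.\<close>

lemma no_relation_along_prime_chain:
  fixes P :: "nat \<Rightarrow> ('n, 'k::field) mpoly set"
  assumes "\<And>i. i \<le> length fs \<Longrightarrow> primeideal (P i) class_ring"
    and "\<And>i. i < length fs \<Longrightarrow> P i \<subseteq> P (Suc i) \<and> fs ! i \<in> P (Suc i) \<and> fs ! i \<notin> P i"
    and "finite E" "E \<noteq> {}" "\<And>es. es \<in> E \<Longrightarrow> length es = length fs \<and> c es \<noteq> 0"
  shows "(\<Sum>es\<in>E. Poly_Mapping.single 0 (c es) * power_product fs es) \<notin> P 0"
  using assms
proof (induction fs arbitrary: P E c)
  case Nil
  \<comment> \<open>With no elements left, the relation is a nonzero constant, hence a unit.\<close>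
  then have E: "E = {[]}" "c [] \<noteq> 0" by auto
  have P: "primeideal (P 0) class_ring" using Nil.prems(1) by simp
  have "1 \<in> P 0" if "Poly_Mapping.single 0 (c []) \<in> P 0"
  proof -
    have "Poly_Mapping.single 0 (inverse (c [])) * Poly_Mapping.single 0 (c []) \<in> P 0"
      using P that unfolding primeideal_class_ring_iff ideal_class_ring_iff by blast
    then show ?thesis using E by (simp add: mult_single)
  qed
  then show ?case using P E by (auto simp: primeideal_class_ring_iff)
next
  case (Cons f fs)
  have P0: "primeideal (P 0) class_ring" and P1: "ideal (P (Suc 0)) class_ring"
    using Cons.prems(1)[of 0] Cons.prems(1)[of "Suc 0"] by (auto simp: primeideal_class_ring_iff)
  have f: "P 0 \<subseteq> P (Suc 0)" "f \<in> P (Suc 0)" "f \<notin> P 0" using Cons.prems(2)[of 0] by auto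
  define a where "a = Min (hd ` E)"
  \<comment> \<open>The tails of the lists that begin with the least exponent; nonempty, so
    \<open>S0\<close> falls under the induction hypothesis.\<close>
  define E0 where "E0 = {es. a # es \<in> E}"
  define E1 where "E1 = {es\<in>E. hd es \<noteq> a}"
  have nonempty: "es \<noteq> []" if "es \<in> E" for es using Cons.prems(5)[OF that] by auto
  have "a \<in> hd ` E" unfolding a_def using Cons.prems(3,4) by (intro Min_in) auto
  then obtain es0 where "es0 \<in> E" "hd es0 = a" by auto
  then have "tl es0 \<in> E0" using nonempty[of es0] by (cases es0) (auto simp: E0_def)
  then have E0: "E0 \<noteq> {}" by auto
  have finE0: "finite E0"
    using finite_vimageI[OF Cons.prems(3), of "(#) a"] by (simp add: E0_def vimage_def)
  have a_le: "a \<le> hd es" if "es \<in> E" for es unfolding a_def using that Cons.prems(3) by simp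
  have E: "E = (#) a ` E0 \<union> E1"
  proof
    show "E \<subseteq> (#) a ` E0 \<union> E1"
    proof
      fix es assume es: "es \<in> E"
      then show "es \<in> (#) a ` E0 \<union> E1"
        using nonempty[OF es] by (cases es) (auto simp: E0_def E1_def)
    qed
  qed (auto simp: E0_def E1_def)
  define S0 where "S0 = (\<Sum>es\<in>E0. Poly_Mapping.single 0 (c (a # es)) * power_product fs es)"
  \<comment> \<open>On \<open>E1\<close> the first exponent exceeds \<open>a\<close>, so the
    subtraction does not truncate.\<close>
  define S1 where "S1 = (\<Sum>es\<in>E1. Poly_Mapping.single 0 (c es) * (f ^ (hd es - a - 1) * power_product fs (tl es)))"
  have "(\<Sum>es\<in>E. Poly_Mapping.single 0 (c es) * power_product (f # fs) es) =
      (\<Sum>es\<in>(#) a ` E0. Poly_Mapping.single 0 (c es) * power_product (f # fs) es) +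
      (\<Sum>es\<in>E1. Poly_Mapping.single 0 (c es) * power_product (f # fs) es)"
    using Cons.prems(3) finE0 unfolding E
    by (subst sum.union_disjoint) (auto simp: E1_def)
  also have "(\<Sum>es\<in>(#) a ` E0. Poly_Mapping.single 0 (c es) * power_product (f # fs) es) = f ^ a * S0"
    by (subst sum.reindex) (auto simp: S0_def sum_distrib_left ac_simps)
  also have "(\<Sum>es\<in>E1. Poly_Mapping.single 0 (c es) * power_product (f # fs) es) = f ^ a * (f * S1)"
    unfolding S1_def sum_distrib_left
  proof (rule sum.cong[OF refl])
    fix es assume es: "es \<in> E1"
    then obtain e es' where es': "es = e # es'" using nonempty[of es] by (cases es) (auto simp: E1_def)
    then have "a < e" using es a_le[of es] by (auto simp: E1_def)
    then obtain d where d: "e = Suc (a + d)" using less_iff_Suc_add by blast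
    have "f ^ e = f ^ a * (f * f ^ (e - a - 1))"
      by (simp add: d power_add ac_simps)
    then show "Poly_Mapping.single 0 (c es) * power_product (f # fs) es =
        f ^ a * (f * (Poly_Mapping.single 0 (c es) * (f ^ (hd es - a - 1) * power_product fs (tl es))))"
      by (simp add: es' ac_simps)
  qed
  finally have eq: "(\<Sum>es\<in>E. Poly_Mapping.single 0 (c es) * power_product (f # fs) es) =
      f ^ a * (S0 + f * S1)" by (simp add: distrib_left)
  \<comment> \<open>The induction hypothesis is used for the chain without
    \<open>P 0\<close>.\<close>
  have S0: "S0 \<notin> P (Suc 0)"
    unfolding S0_def
  proof (rule Cons.IH[of "\<lambda>i. P (Suc i)" E0 "\<lambda>es. c (a # es)"])
    show "primeideal (P (Suc i)) class_ring" if "i \<le> length fs" for i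
      using Cons.prems(1)[of "Suc i"] that by simp
    show "P (Suc i) \<subseteq> P (Suc (Suc i)) \<and> fs ! i \<in> P (Suc (Suc i)) \<and> fs ! i \<notin> P (Suc i)"
      if "i < length fs" for i
      using Cons.prems(2)[of "Suc i"] that by simp
    show "length es = length fs \<and> c (a # es) \<noteq> 0" if "es \<in> E0" for es
      using Cons.prems(5)[of "a # es"] that by (simp add: E0_def)
  qed (fact finE0 E0)+
  show ?case
  proof
    assume "(\<Sum>es\<in>E. Poly_Mapping.single 0 (c es) * power_product (f # fs) es) \<in> P 0"
    then have "f ^ a \<in> P 0 \<or> S0 + f * S1 \<in> P 0"
      unfolding eq using P0 by (auto simp: primeideal_class_ring_iff)
    \<comment> \<open>\<open>f\<close> is outside the prime \<open>P 0\<close>, so the factor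
      \<open>f ^ a\<close> cancels; removing f S1, which lies in the next prime, leaves
      \<open>S0\<close>.\<close>
    then have "S0 + f * S1 \<in> P (Suc 0)" using primeideal_power_mem[OF P0] f by blast
    moreover have "(- S1) * f \<in> P (Suc 0)" using f(2) P1 unfolding ideal_class_ring_iff by blast
    ultimately have "(S0 + f * S1) + (- S1) * f \<in> P (Suc 0)"
      using P1 unfolding ideal_class_ring_iff by blast
    then show False using S0 by (simp add: algebra_simps)
  qed
qed

text \<open>One element from each step of a chain longer than n would give an algebraic relation,
  whose value 0 lies in \<open>P 0\<close>, against
  \<open>no_relation_along_prime_chain\<close>.\<close>

lemma prime_chain_length_le:
  assumes "prime_chain (class_ring :: ('n::finite, 'k::field) mpoly ring) P m"
  shows "m \<le> CARD('n)"
proof (rule ccontr)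
  assume "\<not> m \<le> CARD('n)"
  have "\<forall>i. i < m \<longrightarrow> (\<exists>f. f \<in> P (Suc i) \<and> f \<notin> P i)"
    using assms unfolding prime_chain_def by blast
  then obtain f where f: "\<And>i. i < m \<Longrightarrow> f i \<in> P (Suc i) \<and> f i \<notin> P i" by metis
  define fs where "fs = map f [0..<m]"
  have "CARD('n) < length fs" using \<open>\<not> m \<le> CARD('n)\<close> by (simp add: fs_def)
  from algebraic_dependence[OF this] obtain E and c :: "nat list \<Rightarrow> 'k" where
    E: "finite E" "E \<noteq> {}" "\<And>es. es \<in> E \<Longrightarrow> length es = length fs \<and> c es \<noteq> 0"
    and zero: "(\<Sum>es\<in>E. Poly_Mapping.single 0 (c es) * power_product fs es) = 0" by blast
  have "(\<Sum>es\<in>E. Poly_Mapping.single 0 (c es) * power_product fs es) \<notin> P 0"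
    using assms f by (intro no_relation_along_prime_chain E) (auto simp: fs_def prime_chain_def)
  moreover have "0 \<in> P 0"
    using assms by (simp add: prime_chain_def primeideal_class_ring_iff ideal_class_ring_iff)
  ultimately show False using zero by simp
qed

section \<open>Codimension and dimension over monomial primes\<close>

text \<open>A chain that ends at \<open>var_ideal T\<close> can be continued by adjoining the
  remaining n - card T variables, and its total length is at most n. Adjoining the variables of
  \<open>T\<close> to the zero ideal attains the bound.\<close>

lemma prime_height_var_ideal:
  "prime_height class_ring (var_ideal T :: ('n::finite, 'k::field) mpoly set) = ereal (real (card T))"
proof (rule antisym)
  obtain Q where Q: "prime_chain class_ring Q (card (UNIV - T))"
      "Q 0 = (var_ideal T :: ('n, 'k) mpoly set)"
    using prime_chain_var_ideal[of T UNIV] by auto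
  show "prime_height class_ring (var_ideal T :: ('n, 'k) mpoly set) \<le> ereal (real (card T))"
  proof (rule prime_height_upper)
    fix P m assume P: "prime_chain class_ring P m" "P m = (var_ideal T :: ('n, 'k) mpoly set)"
    have "m + card (UNIV - T) \<le> CARD('n)"
      using prime_chain_length_le[OF prime_chain_append[OF P(1) Q(1)]] P Q by simp
    then have "m \<le> card T" using card_Diff_subset[of T UNIV] card_mono[of UNIV T] by simp
    then show "ereal (real m) \<le> ereal (real (card T))" by simp
  qed
  obtain P where "prime_chain class_ring P (card T)" "P (card T) = (var_ideal T :: ('n, 'k) mpoly set)"
    using prime_chain_var_ideal[of "{}" T] by auto
  then show "ereal (real (card T)) \<le> prime_height class_ring (var_ideal T :: ('n, 'k) mpoly set)"
    by (rule prime_height_lower)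
qed

text \<open>A chain of length m above \<open>I\<close> starts above some \<open>var_ideal T\<close>
  containing \<open>I\<close>; prefixing a chain of length card T gives m + card T \<le> n, while
  the codimension of \<open>I\<close> is at most card T. Conversely, a prime above \<open>I\<close>
  lies above such a \<open>var_ideal T\<close>, so its height is at least card T, and adjoining the
  other variables shows that the dimension is at least n - card T.\<close>

theorem krull_dim_quot_eq:
  fixes I :: "('n::finite, 'k::field) mpoly set"
  assumes I: "ideal I class_ring"
    and var: "\<And>p. primeideal p class_ring \<Longrightarrow> I \<subseteq> p \<Longrightarrow>
      \<exists>T. I \<subseteq> (var_ideal T :: ('n, 'k) mpoly set) \<and> var_ideal T \<subseteq> p"
  shows "krull_dim (class_ring Quot I) = ereal (real CARD('n)) - ideal_codim class_ring I"
proof (rule antisym)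
  note dim = krull_dim_quot[OF class_cring.cring_axioms I]
  show "krull_dim (class_ring Quot I) \<le> ereal (real CARD('n)) - ideal_codim class_ring I"
    unfolding dim
  proof (rule SUP_least)
    fix m assume "m \<in> {m. \<exists>P. prime_chain class_ring P m \<and> I \<subseteq> P 0}"
    then obtain P where P: "prime_chain class_ring P m" "I \<subseteq> P 0" by blast
    then obtain T where T: "I \<subseteq> (var_ideal T :: ('n, 'k) mpoly set)" "var_ideal T \<subseteq> P 0"
      using var[of "P 0"] by (auto simp: prime_chain_def)
    obtain Q where Q: "prime_chain class_ring Q (card T)"
      and QT: "Q (card T) = (var_ideal T :: ('n, 'k) mpoly set)"
      using prime_chain_var_ideal[of "{}" T] by auto
    have "card T + m \<le> CARD('n)"
      using prime_chain_length_le[OF prime_chain_append[OF Q P(1)]] QT T by simp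
    then have le: "real m \<le> real CARD('n) - real (card T)" by simp
    have "ideal_codim class_ring I \<le> ereal (real (card T))"
      unfolding ideal_codim_def prime_height_var_ideal[symmetric, where ?'k = 'k]
      using T primeideal_var_ideal by (intro INF_lower) auto
    then have *: "ereal (real CARD('n)) - ereal (real (card T)) \<le> ereal (real CARD('n)) - ideal_codim class_ring I"
      by (intro ereal_minus_mono) auto
    then show "ereal (real m) \<le> ereal (real CARD('n)) - ideal_codim class_ring I"
      using le by (intro order_trans[OF _ *]) simp
  qed
  have "ereal (real CARD('n)) - krull_dim (class_ring Quot I) \<le> ideal_codim class_ring I"
    unfolding ideal_codim_def
  proof (rule INF_greatest)
    fix p assume "p \<in> {p. primeideal p class_ring \<and> I \<subseteq> p}"
    then have p: "primeideal p class_ring" "I \<subseteq> p" by auto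
    from var[OF p] obtain T where T: "I \<subseteq> (var_ideal T :: ('n, 'k) mpoly set)" "var_ideal T \<subseteq> p" by blast
    obtain Q where Q: "prime_chain class_ring Q (card T)" "Q (card T) = (var_ideal T :: ('n, 'k) mpoly set)"
      using prime_chain_var_ideal[of "{}" T] by auto
    have ht: "ereal (real (card T)) \<le> prime_height class_ring p"
      using prime_height_mono_chain[OF Q(1) _ p(1)] Q(2) T(2) by simp
    obtain P where "prime_chain class_ring P (card (UNIV - T))" "P 0 = (var_ideal T :: ('n, 'k) mpoly set)"
      using prime_chain_var_ideal[of T UNIV] by auto
    then have "ereal (real (card (UNIV - T))) \<le> krull_dim (class_ring Quot I)"
      unfolding dim using T(1) by (intro SUP_upper) auto
    moreover have "real (card (UNIV - T)) = real CARD('n) - real (card T)"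
      using card_Diff_subset[of T UNIV] card_mono[of UNIV T] by (simp add: of_nat_diff)
    ultimately have "ereal (real CARD('n) - real (card T)) \<le> krull_dim (class_ring Quot I)" by simp
    then have "ereal (real CARD('n)) - krull_dim (class_ring Quot I) \<le>
        ereal (real CARD('n)) - ereal (real CARD('n) - real (card T))"
      by (intro ereal_minus_mono) auto
    then show "ereal (real CARD('n)) - krull_dim (class_ring Quot I) \<le> prime_height class_ring p"
      using ht by (intro order_trans[OF _ ht]) simp
  qed
  \<comment> \<open>For the unit ideal both quantities are infinite, so the rearrangement goes
    through the cases of extended reals.\<close>
  then show "ereal (real CARD('n)) - ideal_codim class_ring I \<le> krull_dim (class_ring Quot I)"
    by (cases "krull_dim (class_ring Quot I)"; cases "ideal_codim class_ring I") auto
qed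

section \<open>The annihilator of a cokernel\<close>

text \<open>The coset of y is zero exactly when y lies in the image of \<open>A\<close>.\<close>

lemma mem_annihilator_mat_cokernel_iff:
  fixes A :: "'a::comm_ring_1 mat"
  shows "r \<in> annihilator class_ring (mat_cokernel A) \<longleftrightarrow>
    (\<forall>x\<in>carrier_vec (dim_row A). \<exists>w\<in>carrier_vec (dim_col A). r \<cdot>\<^sub>v x = A *\<^sub>v w)"
proof -
  define M where "M = module_vec TYPE('a) (dim_row A)"
  define N where "N = (\<lambda>w. A *\<^sub>v w) ` carrier_vec (dim_col A)"
  have sub: "LinearCombinations.submodule class_ring N M"
    unfolding M_def N_def by (rule mat_range_submodule)
  interpret sub: LinearCombinations.submodule class_ring N M by (rule sub)
  interpret M: Module.module class_ring M by (rule sub.module)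
  interpret N: abelian_subgroup N M by (rule submodule_abelian_subgroup[OF sub])
  have coset: "N +>\<^bsub>M\<^esub> y = N \<longleftrightarrow> y \<in> N" if "y \<in> carrier M" for y
    using M.a_coset_join1[OF _ that N.a_subgroup] M.a_coset_join2[OF that N.a_subgroup] by blast
  have carr: "carrier (quot_module M N) = (\<lambda>x. N +>\<^bsub>M\<^esub> x) ` carrier M"
    by (auto simp: quot_module_def A_RCOSETS_def')
  have zero: "\<zero>\<^bsub>quot_module M N\<^esub> = N" by (simp add: quot_module_def)
  have "r \<in> annihilator class_ring (mat_cokernel A) \<longleftrightarrow>
      (\<forall>x\<in>carrier M. r \<odot>\<^bsub>quot_module M N\<^esub> (N +>\<^bsub>M\<^esub> x) = N)"
    unfolding annihilator_def mat_cokernel_def M_def[symmetric] N_def[symmetric] carr zero by simp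
  also have "\<dots> \<longleftrightarrow> (\<forall>x\<in>carrier M. r \<odot>\<^bsub>M\<^esub> x \<in> N)"
    using coset M.smult_closed by (simp add: quot_module_smult_coset[OF sub])
  also have "\<dots> \<longleftrightarrow> (\<forall>x\<in>carrier_vec (dim_row A). \<exists>w\<in>carrier_vec (dim_col A). r \<cdot>\<^sub>v x = A *\<^sub>v w)"
    unfolding N_def image_iff by (simp add: M_def module_vec_simps)
  finally show ?thesis .
qed

lemma ideal_annihilator_mat_cokernel:
  fixes A :: "'a::comm_ring_1 mat"
  shows "ideal (annihilator class_ring (mat_cokernel A)) class_ring"
  unfolding ideal_class_ring_iff mem_annihilator_mat_cokernel_iff
proof (intro conjI ballI allI)
  fix x :: "'a vec" assume x: "x \<in> carrier_vec (dim_row A)"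
  show "\<exists>w\<in>carrier_vec (dim_col A). 0 \<cdot>\<^sub>v x = A *\<^sub>v w"
    using x by (intro bexI[of _ "0\<^sub>v (dim_col A)"] eq_vecI) auto
next
  fix a b :: 'a and x :: "'a vec"
  assume ab: "a \<in> annihilator class_ring (mat_cokernel A)" "b \<in> annihilator class_ring (mat_cokernel A)"
    and x: "x \<in> carrier_vec (dim_row A)"
  obtain v w where vw: "v \<in> carrier_vec (dim_col A)" "a \<cdot>\<^sub>v x = A *\<^sub>v v"
    "w \<in> carrier_vec (dim_col A)" "b \<cdot>\<^sub>v x = A *\<^sub>v w"
    using ab x unfolding mem_annihilator_mat_cokernel_iff by blast
  then have "(a + b) \<cdot>\<^sub>v x = A *\<^sub>v (v + w)"
    using mult_add_distrib_mat_vec[of A "dim_row A" "dim_col A" v w] by (simp add: add_smult_distrib_vec)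
  then show "\<exists>w\<in>carrier_vec (dim_col A). (a + b) \<cdot>\<^sub>v x = A *\<^sub>v w" using vw by (intro bexI[of _ "v + w"]) auto
next
  fix r a :: 'a and x :: "'a vec"
  assume a: "a \<in> annihilator class_ring (mat_cokernel A)" and x: "x \<in> carrier_vec (dim_row A)"
  have "r \<cdot>\<^sub>v x \<in> carrier_vec (dim_row A)" using x by simp
  then obtain w where "w \<in> carrier_vec (dim_col A)" "a \<cdot>\<^sub>v (r \<cdot>\<^sub>v x) = A *\<^sub>v w"
    using a unfolding mem_annihilator_mat_cokernel_iff by blast
  then show "\<exists>w\<in>carrier_vec (dim_col A). (r * a) \<cdot>\<^sub>v x = A *\<^sub>v w"
    by (auto simp: smult_smult_assoc mult.commute)
qed

section \<open>Minors and the annihilator\<close>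

lemma pick_lessThan: "i < n \<Longrightarrow> pick {..<n} i = i"
proof -
  assume "i < n"
  then have "{a \<in> {..<n}. a < i} = {..<i}" by auto
  then show ?thesis using pick_card_in_set[of i "{..<n}"] \<open>i < n\<close> by simp
qed

text \<open>\<open>pick\<close> enumerates an index set increasingly and is the identity on an
  initial segment, so only the columns are renumbered.\<close>

lemma lessThan_submatrix:
  assumes A: "A \<in> carrier_mat s l" and "t \<le> s" "K \<subseteq> {..<l}" "card K = t"
  shows "submatrix A {..<t} K = mat t t (\<lambda>(i, j). A $$ (i, pick K j))"
proof -
  have "{i. i < s \<and> i < t} = {..<t}" "{j. j < l \<and> j \<in> K} = K" using assms by auto
  then show ?thesis using assms by (intro eq_matI) (auto simp: submatrix_def pick_lessThan)
qed

lemma pick_less: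
  assumes "K \<subseteq> {..<l}" "j < card K"
  shows "pick K j \<in> K" "pick K j < l"
  using pick_in_set_le[OF assms(2)] assms(1) by auto

text \<open>\<open>B\<close> is \<open>A\<close> times a selection matrix, and \<open>B\<close> times its adjugate is scalar.\<close>

lemma maximal_minor_mem_annihilator:
  fixes A :: "'a::comm_ring_1 mat"
  assumes A: "A \<in> carrier_mat s l" and K: "K \<subseteq> {..<l}" "card K = s"
  shows "det (submatrix A {..<s} K) \<in> annihilator class_ring (mat_cokernel A)"
  unfolding mem_annihilator_mat_cokernel_iff
proof
  fix x :: "'a vec" assume "x \<in> carrier_vec (dim_row A)"
  then have x: "x \<in> carrier_vec s" using A by simp
  define B where "B = submatrix A {..<s} K"
  \<comment> \<open>Column \<open>q\<close> of \<open>S\<close> is the unit vector at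
    \<open>pick K q\<close>, so A S extracts the columns in \<open>K\<close>.\<close>
  define S where "S = mat l s (\<lambda>(j, q). if j = pick K q then 1 else (0 :: 'a))"
  have B_eq: "B = mat s s (\<lambda>(i, j). A $$ (i, pick K j))"
    unfolding B_def by (rule lessThan_submatrix[OF A order_refl K])
  have S: "S \<in> carrier_mat l s" by (simp add: S_def)
  have B: "B \<in> carrier_mat s s" by (simp add: B_eq)
  have AS: "B = A * S"
  proof (rule eq_matI)
    fix i q assume "i < dim_row (A * S)" "q < dim_col (A * S)"
    then have i: "i < s" and q: "q < s" using A S by auto
    have "(A * S) $$ (i, q) = (\<Sum>j<l. A $$ (i, j) * (if j = pick K q then 1 else 0))"
      using i q A by (simp add: S_def scalar_prod_def lessThan_atLeast0)
    also have "\<dots> = A $$ (i, pick K q)"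
      using pick_less[OF K(1), of q] q K(2) by (simp add: if_distrib cong: if_cong)
    finally show "B $$ (i, q) = (A * S) $$ (i, q)" using i q by (simp add: B_eq)
  qed (use A S in \<open>auto simp: B_eq\<close>)
  note adj = adj_mat[OF B]
  have y: "adj_mat B *\<^sub>v x \<in> carrier_vec s" using adj(1) x by simp
  have "A *\<^sub>v (S *\<^sub>v (adj_mat B *\<^sub>v x)) = B *\<^sub>v (adj_mat B *\<^sub>v x)"
    using assoc_mult_mat_vec[OF A S y] by (simp add: AS)
  also have "\<dots> = (B * adj_mat B) *\<^sub>v x"
    using assoc_mult_mat_vec[OF B adj(1) x] by simp
  also have "\<dots> = det B \<cdot>\<^sub>v x"
  proof -
    have "(det B \<cdot>\<^sub>m 1\<^sub>m s) *\<^sub>v x = det B \<cdot>\<^sub>v (1\<^sub>m s *\<^sub>v x)" using x by auto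
    then show ?thesis unfolding adj(2) using x by simp
  qed
  finally show "\<exists>w\<in>carrier_vec (dim_col A). det (submatrix A {..<s} K) \<cdot>\<^sub>v x = A *\<^sub>v w"
    using A S adj(1) x unfolding B_def[symmetric]
    by (intro bexI[of _ "S *\<^sub>v (adj_mat B *\<^sub>v x)"]) auto
qed

text \<open>The \<open>u i\<close> are the cofactors of an arbitrary last column put next to the first \<open>t + 1\<close>
  rows of the columns in \<open>N\<close>; they form a row vector that annihilates those columns.\<close>

lemma annihilator_mult_minor_mem:
  fixes A :: "'a::comm_ring_1 mat"
  assumes A: "A \<in> carrier_mat s l" and P: "ideal P class_ring"
    and N: "N \<subseteq> {..<l}" "card N = t" "t < s"
    and entries: "\<And>i j. i < s \<Longrightarrow> j < l \<Longrightarrow> j \<notin> N \<Longrightarrow> A $$ (i, j) \<in> P"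
    and r: "r \<in> annihilator class_ring (mat_cokernel A)"
  shows "r * det (submatrix A {..<t} N) \<in> P"
proof -
  define B where "B x = mat (Suc t) (Suc t) (\<lambda>(i, j). if j < t then A $$ (i, pick N j) else x i)" for x :: "nat \<Rightarrow> 'a"
  define u where "u i = cofactor (B (\<lambda>_. 0)) i t" for i
  have B: "B x \<in> carrier_mat (Suc t) (Suc t)" for x by (simp add: B_def)
  \<comment> \<open>Deleting the last column removes all dependence on \<open>x\<close>.\<close>
  have "mat_delete (B x) i t = mat_delete (B y) i t" for x y i
    by (intro eq_matI) (auto simp: mat_delete_def B_def)
  then have cof: "cofactor (B x) i t = u i" for x i
    unfolding u_def cofactor_def by metis
  have detB: "det (B x) = (\<Sum>i<Suc t. x i * u i)" for x
    unfolding laplace_expansion_column[OF B lessI] cof by (intro sum.cong) (auto simp: B_def)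
  \<comment> \<open>A column of \<open>N\<close> put in the last place repeats an earlier
    column.\<close>
  have kernel: "(\<Sum>i<Suc t. A $$ (i, j) * u i) = 0" if "j \<in> N" for j
  proof -
    define q where "q = card {a\<in>N. a < j}"
    have "finite N" using N(1) finite_subset by blast
    then have q: "q < t" unfolding q_def N(2)[symmetric] using that by (intro psubset_card_mono) auto
    have "pick N q = j" unfolding q_def by (rule pick_card_in_set[OF that])
    then have "col (B (\<lambda>i. A $$ (i, j))) q = col (B (\<lambda>i. A $$ (i, j))) t"
      using q by (intro eq_vecI) (auto simp: B_def)
    then have "det (B (\<lambda>i. A $$ (i, j))) = 0"
      using q by (intro det_identical_columns[OF B, of q t]) auto
    then show ?thesis by (simp add: detB)
  qed
  have "mat_delete (B (\<lambda>_. 0)) t t = submatrix A {..<t} N"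
    unfolding lessThan_submatrix[OF A less_imp_le[OF N(3)] N(1,2)]
    by (intro eq_matI) (auto simp: mat_delete_def B_def)
  \<comment> \<open>The sign of the cofactor at (t, t) is even.\<close>
  then have ut: "u t = det (submatrix A {..<t} N)"
    by (simp add: u_def cofactor_def mult_2[symmetric])
  \<comment> \<open>Pairing \<open>u\<close> with r e_t = A w gives r u_t on the left; on the right
    the columns in \<open>N\<close> contribute 0 and the others elements of
    \<open>P\<close>.\<close>
  have "unit_vec s t \<in> carrier_vec (dim_row A)" using A by simp
  with r obtain w where w: "w \<in> carrier_vec (dim_col A)" "r \<cdot>\<^sub>v unit_vec s t = A *\<^sub>v w"
    unfolding mem_annihilator_mat_cokernel_iff by blast
  have Aw: "(if i = t then r else 0) = (\<Sum>j<l. A $$ (i, j) * w $ j)" if "i < Suc t" for i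
  proof -
    have i: "i < s" using that N(3) by simp
    have "(if i = t then r else 0) = (r \<cdot>\<^sub>v unit_vec s t) $ i" using i N(3) by simp
    also have "\<dots> = (\<Sum>j<l. A $$ (i, j) * w $ j)"
      unfolding w(2) using i A w(1) by (simp add: scalar_prod_def lessThan_atLeast0)
    finally show ?thesis .
  qed
  have "r * u t = (\<Sum>i<Suc t. (if i = t then r else 0) * u i)" by (simp add: if_distrib cong: if_cong)
  also have "\<dots> = (\<Sum>i<Suc t. (\<Sum>j<l. A $$ (i, j) * w $ j) * u i)"
    using Aw by (intro sum.cong) auto
  also have "\<dots> = (\<Sum>j<l. w $ j * (\<Sum>i<Suc t. A $$ (i, j) * u i))"
    unfolding sum_distrib_left sum_distrib_right
    by (subst sum.swap) (simp add: ac_simps)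
  also have "\<dots> \<in> P"
  proof (rule ideal_sum_mem[OF P])
    fix j assume "j \<in> {..<l}"
    then have j: "j < l" by simp
    have "(\<Sum>i<Suc t. A $$ (i, j) * u i) \<in> P"
    proof (cases "j \<in> N")
      case True
      then show ?thesis using kernel P by (simp add: ideal_class_ring_iff)
    next
      case False
      then have "u i * A $$ (i, j) \<in> P" if "i < Suc t" for i
        using entries[of i j] j N(3) that P by (simp add: ideal_class_ring_iff)
      then show ?thesis by (intro ideal_sum_mem[OF P]) (simp add: mult.commute)
    qed
    then show "w $ j * (\<Sum>i<Suc t. A $$ (i, j) * u i) \<in> P"
      using P by (simp add: ideal_class_ring_iff)
  qed
  finally show ?thesis by (simp add: ut)
qed

text \<open>Coordinate \<open>i\<close> of r e_i = A w expresses \<open>r\<close> as a combination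
  of the entries of row \<open>i\<close>.\<close>

lemma annihilator_mem_if_row_mem:
  fixes A :: "'a::comm_ring_1 mat"
  assumes A: "A \<in> carrier_mat s l" and P: "ideal P class_ring"
    and i: "i < s" and row: "\<And>j. j < l \<Longrightarrow> A $$ (i, j) \<in> P"
    and r: "r \<in> annihilator class_ring (mat_cokernel A)"
  shows "r \<in> P"
proof -
  have "unit_vec s i \<in> carrier_vec (dim_row A)" using A by simp
  with r obtain w where w: "w \<in> carrier_vec (dim_col A)" "r \<cdot>\<^sub>v unit_vec s i = A *\<^sub>v w"
    unfolding mem_annihilator_mat_cokernel_iff by blast
  have "r = (r \<cdot>\<^sub>v unit_vec s i) $ i" using i by simp
  also have "\<dots> = (\<Sum>j<l. w $ j * A $$ (i, j))"
    unfolding w(2) using i A w(1) by (simp add: scalar_prod_def lessThan_atLeast0 mult.commute)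
  also have "\<dots> \<in> P"
    using row P by (intro ideal_sum_mem) (auto simp: ideal_class_ring_iff)
  finally show ?thesis .
qed

section \<open>Primes containing the annihilator\<close>

lemma INF_UNION: "(INF x\<in>(\<Union>y\<in>A. g y). f x) = (INF y\<in>A. INF x\<in>g y. (f x :: 'b::complete_lattice))"
  by (rule order_antisym) (blast intro: INF_greatest INF_lower2)+

lemma lookup_lcm_exponent_neq_0_iff:
  assumes "finite E" "E \<noteq> {}"
  shows "Poly_Mapping.lookup (lcm_exponent E) v \<noteq> 0 \<longleftrightarrow> (\<exists>a\<in>E. Poly_Mapping.lookup a v \<noteq> 0)"
proof -
  have "0 < Max ((\<lambda>a. Poly_Mapping.lookup a v) ` E) \<longleftrightarrow> (\<exists>a\<in>E. 0 < Poly_Mapping.lookup a v)"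
    using assms by (subst Max_gr_iff) auto
  then show ?thesis unfolding lookup_lcm_exponent by simp
qed

text \<open>A prime contains a monomial iff it contains one of its variables, and the variables of
  an lcm are those of its members. So containment depends only on the variables in \<open>P\<close>
  and says that at most s - i entries of row \<open>i\<close> avoid them.\<close>

lemma lcm_ideal_subset_primeideal_iff:
  fixes P :: "('n::finite, 'k::field) mpoly set"
  assumes "primeideal P class_ring"
  shows "lcm_ideal s l \<alpha> i \<subseteq> P \<longleftrightarrow>
    (\<forall>J. J \<subseteq> {1..l} \<and> card J = s - i + 1 \<longrightarrow>
      (\<exists>j\<in>J. \<exists>v. mvar v \<in> P \<and> Poly_Mapping.lookup (\<alpha> i j) v \<noteq> 0))"
proof -
  have P: "ideal P class_ring" using assms by (simp add: primeideal_class_ring_iff)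
  have mem: "Poly_Mapping.single (lcm_exponent (\<alpha> i ` J)) 1 \<in> P \<longleftrightarrow>
      (\<exists>j\<in>J. \<exists>v. mvar v \<in> P \<and> Poly_Mapping.lookup (\<alpha> i j) v \<noteq> 0)"
    if "card J = s - i + 1" for J
  proof -
    have "finite J" "J \<noteq> {}" using that card.infinite[of J] by auto
    then have *: "Poly_Mapping.lookup (lcm_exponent (\<alpha> i ` J)) v \<noteq> 0 \<longleftrightarrow>
        (\<exists>j\<in>J. Poly_Mapping.lookup (\<alpha> i j) v \<noteq> 0)" for v
      by (subst lookup_lcm_exponent_neq_0_iff) auto
    have "Poly_Mapping.single (lcm_exponent (\<alpha> i ` J)) 1 \<in> P \<longleftrightarrow>
        (\<exists>v. Poly_Mapping.lookup (lcm_exponent (\<alpha> i ` J)) v \<noteq> 0 \<and> mvar v \<in> P)"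
      using single_mem_primeideal[OF assms] single_mem_ideal[OF P] by (metis zero_neq_one)
    then show ?thesis unfolding * by blast
  qed
  have "lcm_ideal s l \<alpha> i \<subseteq> P \<longleftrightarrow> (\<forall>J. J \<subseteq> {1..l} \<and> card J = s - i + 1 \<longrightarrow>
      Poly_Mapping.single (lcm_exponent (\<alpha> i ` J)) 1 \<in> P)"
    unfolding lcm_ideal_def genideal_subset_iff[OF P] by blast
  then show ?thesis using mem by (simp cong: conj_cong imp_cong)
qed

text \<open>For a squarefree solution, \<open>alternative\<close> holds because \<open>\<beta> i v = 1\<close> for some \<open>i\<close> forces
  \<open>\<gamma> j v = 1\<close> for all \<open>j\<close>, and otherwise \<open>\<alpha> i j v = \<gamma> j v\<close>.\<close>

locale squarefree_uniform_matrix =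
  fixes s l :: nat
    and c :: "nat \<Rightarrow> nat \<Rightarrow> 'k::field"
    and \<alpha> :: "nat \<Rightarrow> nat \<Rightarrow> 'n::finite \<Rightarrow>\<^sub>0 nat"
    and A :: "('n, 'k) mpoly mat"
  assumes A_eq: "A = term_mat s l c \<alpha>"
    and multigraded: "multigraded A"
    and uniform_rank: "uniform_rank A"
    and alternative: "\<And>v.
      (\<forall>i\<in>{1..s}. \<forall>j\<in>{1..l}. \<forall>j'\<in>{1..l}.
         Poly_Mapping.lookup (\<alpha> i j) v = Poly_Mapping.lookup (\<alpha> i j') v) \<or>
      (\<forall>i\<in>{1..s}. \<forall>i'\<in>{1..s}. \<forall>j\<in>{1..l}.
         Poly_Mapping.lookup (\<alpha> i j) v = Poly_Mapping.lookup (\<alpha> i' j) v)"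
begin

lemma A_carrier: "A \<in> carrier_mat s l"
  by (simp add: A_eq term_mat_def)

lemma A_index:
  "i < s \<Longrightarrow> j < l \<Longrightarrow> A $$ (i, j) = Poly_Mapping.single (\<alpha> (Suc i) (Suc j)) (c (Suc i) (Suc j))"
  by (simp add: A_eq term_mat_def)

lemma lessThan_minor:
  assumes "t \<le> s" "K \<subseteq> {..<l}" "card K = t"
  shows "\<exists>e d. det (submatrix A {..<t} K) = Poly_Mapping.single e d \<and> d \<noteq> 0"
proof -
  have *: "{..<t} \<subseteq> {..<dim_row A} \<and> K \<subseteq> {..<dim_col A} \<and> card {..<t} = card K"
    using A_carrier assms by auto
  obtain e d where "det (submatrix A {..<t} K) = Poly_Mapping.single e d"
    using multigraded * unfolding multigraded_def by blast
  moreover have "det (submatrix A {..<t} K) \<noteq> 0"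
    using uniform_rank * unfolding uniform_rank_def by blast
  ultimately show ?thesis by (metis single_zero)
qed

lemma lessThan_minor_free_of:
  assumes "t \<le> s" "K \<subseteq> {..<l}" "card K = t"
    and "\<And>i j v. i < t \<Longrightarrow> j \<in> K \<Longrightarrow> v \<in> T \<Longrightarrow> Poly_Mapping.lookup (\<alpha> (Suc i) (Suc j)) v = 0"
  shows "det (submatrix A {..<t} K) \<in> free_of T"
  unfolding lessThan_submatrix[OF A_carrier assms(1-3)]
proof (rule det_mem_free_of)
  fix i j assume "i < dim_row (mat t t (\<lambda>(i, j). A $$ (i, pick K j)))"
    "j < dim_col (mat t t (\<lambda>(i, j). A $$ (i, pick K j)))"
  then have ij: "i < t" "j < t" by auto
  then have "pick K j \<in> K" "pick K j < l" using pick_less[OF assms(2)] assms(3) by auto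
  then show "mat t t (\<lambda>(i, j). A $$ (i, pick K j)) $$ (i, j) \<in> free_of T"
    using ij assms(1,4) by (auto simp: A_index intro!: single_mem_free_of)
qed

lemma lcm_ideal_subset_if_annihilator_subset:
  assumes p: "primeideal p class_ring"
    and ann: "annihilator class_ring (mat_cokernel A) \<subseteq> p"
  shows "\<exists>i\<in>{1..s}. lcm_ideal s l \<alpha> i \<subseteq> p"
proof (cases "\<exists>i\<in>{1..s}. \<exists>v. mvar v \<in> p \<and> (\<forall>j\<in>{1..l}. Poly_Mapping.lookup (\<alpha> i j) v \<noteq> 0)")
  case True
  then obtain i v where iv: "i \<in> {1..s}" "mvar v \<in> p"
    "\<forall>j\<in>{1..l}. Poly_Mapping.lookup (\<alpha> i j) v \<noteq> 0" by blast
  \<comment> \<open>\<open>J\<close> is nonempty by its size, and \<open>v\<close> divides every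
    entry of row \<open>i\<close>.\<close>
  have "\<exists>j\<in>J. \<exists>v. mvar v \<in> p \<and> Poly_Mapping.lookup (\<alpha> i j) v \<noteq> 0"
    if "J \<subseteq> {1..l}" "card J = s - i + 1" for J
  proof -
    obtain j where "j \<in> J" using \<open>card J = s - i + 1\<close> by fastforce
    then show ?thesis using iv that(1) by blast
  qed
  then have "lcm_ideal s l \<alpha> i \<subseteq> p" unfolding lcm_ideal_subset_primeideal_iff[OF p] by blast
  then show ?thesis using iv(1) by blast
next
  case False
  \<comment> \<open>The conjunct \<open>1 \<le> s\<close> rules out s = 0, where the minor is a
    nonzero constant and cannot lie in a prime.\<close>
  have minor: "1 \<le> s \<and> (\<exists>j\<in>J. \<exists>v. mvar v \<in> p \<and> Poly_Mapping.lookup (\<alpha> 1 j) v \<noteq> 0)"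
    if J: "J \<subseteq> {1..l}" "card J = s" for J
  proof (rule ccontr)
    assume n: "\<not> ?thesis"
    \<comment> \<open>Column numbers from 1 become matrix indices from 0.\<close>
    define K where "K = (\<lambda>j. j - 1) ` J"
    have K: "K \<subseteq> {..<l}" using J by (fastforce simp: K_def)
    have "inj_on (\<lambda>j. j - 1) J" 
    proof (rule inj_onI)
      fix x y assume "x \<in> J" "y \<in> J" "x - 1 = y - 1"
      moreover from this have "1 \<le> x" "1 \<le> y" using J(1) by auto
      ultimately show "x = y" by simp
    qed
    then have card: "card K = s" using J by (simp add: K_def card_image)
    have SucK: "Suc j \<in> J" if "j \<in> K" for j using that J by (auto simp: K_def)
    obtain e d where ed: "det (submatrix A {..<s} K) = Poly_Mapping.single e d" "d \<noteq> 0"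
      using lessThan_minor[OF order_refl K card] by blast
    have "Poly_Mapping.single e d \<in> p"
      using maximal_minor_mem_annihilator[OF A_carrier K card] ann unfolding ed by blast
    from single_mem_primeideal[OF p this ed(2)] obtain v where
      v: "Poly_Mapping.lookup e v \<noteq> 0" "mvar v \<in> p" by blast
    \<comment> \<open>If \<open>v\<close> occurred here with a column-independent exponent, it would
      divide a whole row; with a row-independent one, it would occur in row 1. Both are excluded,
      yet \<open>v\<close> divides the minor.\<close>
    have "Poly_Mapping.lookup (\<alpha> (Suc i) (Suc j)) v = 0" if i: "i < s" and j: "j \<in> K" for i j
    proof (rule ccontr)
      assume nz: "Poly_Mapping.lookup (\<alpha> (Suc i) (Suc j)) v \<noteq> 0"
      have ij: "Suc i \<in> {1..s}" "Suc j \<in> {1..l}" "1 \<in> {1..s}" using i K j by auto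
      show False
        using alternative[of v]
      proof
        assume "\<forall>i\<in>{1..s}. \<forall>j\<in>{1..l}. \<forall>j'\<in>{1..l}.
          Poly_Mapping.lookup (\<alpha> i j) v = Poly_Mapping.lookup (\<alpha> i j') v"
        then have "\<forall>j'\<in>{1..l}. Poly_Mapping.lookup (\<alpha> (Suc i) j') v \<noteq> 0" using nz ij by metis
        then show False using False v(2) ij(1) by blast
      next
        assume "\<forall>i\<in>{1..s}. \<forall>i'\<in>{1..s}. \<forall>j\<in>{1..l}.
          Poly_Mapping.lookup (\<alpha> i j) v = Poly_Mapping.lookup (\<alpha> i' j) v"
        then have "Poly_Mapping.lookup (\<alpha> 1 (Suc j)) v \<noteq> 0" using nz ij by metis
        then show False using n v(2) i SucK[OF j] by auto
      qed
    qed
    then have "Poly_Mapping.single e d \<in> free_of {v}"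
      unfolding ed(1)[symmetric] by (intro lessThan_minor_free_of[OF order_refl K card]) simp
    then show False using v(1) ed(2) by (simp add: free_of_def)
  qed
  have s: "1 \<in> {1..s}" using minor[of "{}"] by fastforce
  have "lcm_ideal s l \<alpha> 1 \<subseteq> p"
    unfolding lcm_ideal_subset_primeideal_iff[OF p] 
  proof (intro allI impI)
    fix J assume "J \<subseteq> {1..l} \<and> card J = s - 1 + 1"
    then show "\<exists>j\<in>J. \<exists>v. mvar v \<in> p \<and> Poly_Mapping.lookup (\<alpha> 1 j) v \<noteq> 0"
      using minor[of J] s by auto
  qed
  then show ?thesis using s by blast
qed

lemma annihilator_subset_if_lcm_ideal_subset:
  assumes p: "primeideal p class_ring"
    and i: "i \<in> {1..s}" and sub: "lcm_ideal s l \<alpha> i \<subseteq> p"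
  shows "annihilator class_ring (mat_cokernel A) \<subseteq> p"
proof
  fix r assume r: "r \<in> annihilator class_ring (mat_cokernel A)"
  have idp: "ideal p class_ring" using p by (simp add: primeideal_class_ring_iff)
  show "r \<in> p"
  proof (cases "\<exists>v. mvar v \<in> p \<and> (\<exists>i\<in>{1..s}. \<forall>j\<in>{1..l}. Poly_Mapping.lookup (\<alpha> i j) v \<noteq> 0)")
    case True
    then obtain v i' where v: "mvar v \<in> p" "i' \<in> {1..s}"
      "\<forall>j\<in>{1..l}. Poly_Mapping.lookup (\<alpha> i' j) v \<noteq> 0" by blast
    have i': "i' - 1 < s" "Suc (i' - 1) = i'" using v(2) by auto
    show ?thesis
    proof (rule annihilator_mem_if_row_mem[OF A_carrier idp i'(1) _ r])
      fix j assume j: "j < l"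
      then show "A $$ (i' - 1, j) \<in> p"
        unfolding A_index[OF i'(1) j] i'(2) using v by (intro single_mem_ideal[OF idp v(1)]) auto
    qed
  next
    case False
    \<comment> \<open>The variables of \<open>p\<close> with row-independent exponents; a nonzero
      polynomial free of them stays nonzero modulo the prime \<open>var_ideal T\<close>.\<close>
    define T where "T = {v. mvar v \<in> p \<and> (\<forall>i\<in>{1..s}. \<forall>i'\<in>{1..s}. \<forall>j\<in>{1..l}.
      Poly_Mapping.lookup (\<alpha> i j) v = Poly_Mapping.lookup (\<alpha> i' j) v)}"
    \<comment> \<open>The columns that survive in row \<open>i\<close> when the variables of
      \<open>p\<close> are set to 0.\<close>
    define N where "N = {j\<in>{..<l}. \<forall>v. mvar v \<in> p \<longrightarrow> Poly_Mapping.lookup (\<alpha> i (Suc j)) v = 0}"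
    have N: "N \<subseteq> {..<l}" by (auto simp: N_def)
    \<comment> \<open>Otherwise some s - i + 1 of these columns would have an lcm outside
      \<open>p\<close>. As i is at least 1, fewer than s columns survive.\<close>
    have "card N < s - i + 1"
    proof (rule ccontr)
      assume "\<not> card N < s - i + 1"
      then obtain K where K: "K \<subseteq> N" "card K = s - i + 1"
        using obtain_subset_with_card_n[of "s - i + 1" N] by (metis not_less)
      have "Suc ` K \<subseteq> {1..l}" "card (Suc ` K) = s - i + 1" using K N by (auto simp: card_image)
      then obtain j v where "j \<in> K" "mvar v \<in> p" "Poly_Mapping.lookup (\<alpha> i (Suc j)) v \<noteq> 0"
        using sub unfolding lcm_ideal_subset_primeideal_iff[OF p] by (metis (no_types, lifting) imageE)
      then show False using K(1) by (auto simp: N_def)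
    qed
    then have less: "card N < s" using i by auto
    \<comment> \<open>A variable of \<open>p\<close> in row \<open>i\<close> of column
      \<open>j\<close> cannot be column-independent, since it would divide all of row
      \<open>i\<close>. So it belongs to \<open>T\<close> and divides the whole column.\<close>
    have entries: "A $$ (i', j) \<in> var_ideal T" if ij: "i' < s" "j < l" "j \<notin> N" for i' j
    proof -
      obtain v where v: "mvar v \<in> p" "Poly_Mapping.lookup (\<alpha> i (Suc j)) v \<noteq> 0"
        using ij by (auto simp: N_def)
      have mem: "Suc i' \<in> {1..s}" "Suc j \<in> {1..l}" using ij by auto
      have "\<not> (\<forall>i\<in>{1..s}. \<forall>j\<in>{1..l}. \<forall>j'\<in>{1..l}.
          Poly_Mapping.lookup (\<alpha> i j) v = Poly_Mapping.lookup (\<alpha> i j') v)"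
      proof
        assume "\<forall>i\<in>{1..s}. \<forall>j\<in>{1..l}. \<forall>j'\<in>{1..l}.
          Poly_Mapping.lookup (\<alpha> i j) v = Poly_Mapping.lookup (\<alpha> i j') v"
        then have "\<forall>j'\<in>{1..l}. Poly_Mapping.lookup (\<alpha> i j') v \<noteq> 0" using v(2) mem(2) i by metis
        then show False using False v(1) i by blast
      qed
      with alternative[of v] have col: "\<forall>i\<in>{1..s}. \<forall>i'\<in>{1..s}. \<forall>j\<in>{1..l}.
          Poly_Mapping.lookup (\<alpha> i j) v = Poly_Mapping.lookup (\<alpha> i' j) v" by blast
      then have "v \<in> T" using v(1) unfolding T_def by blast
      moreover have "Poly_Mapping.lookup (\<alpha> (Suc i') (Suc j)) v \<noteq> 0" using col v(2) mem i by metis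
      ultimately show ?thesis unfolding A_index[OF ij(1,2)] by (rule single_mem_var_ideal)
    qed
    have rdet: "r * det (submatrix A {..<card N} N) \<in> var_ideal T"
      by (rule annihilator_mult_minor_mem[OF A_carrier ideal_var_ideal N refl less entries r])
    \<comment> \<open>By row-independence, a variable of \<open>T\<close> missing from row
      \<open>i\<close> of a column is missing from the whole column.\<close>
    have "det (submatrix A {..<card N} N) \<in> free_of T"
    proof (rule lessThan_minor_free_of[OF less_imp_le[OF less] N refl])
      fix i' j v assume *: "i' < card N" "j \<in> N" "v \<in> T"
      then have mem: "Suc i' \<in> {1..s}" "Suc j \<in> {1..l}" using less N by auto
      have "Poly_Mapping.lookup (\<alpha> (Suc i') (Suc j)) v = Poly_Mapping.lookup (\<alpha> i (Suc j)) v"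
        using *(3) mem i unfolding T_def by blast
      then show "Poly_Mapping.lookup (\<alpha> (Suc i') (Suc j)) v = 0"
        using * by (simp add: N_def T_def)
    qed
    moreover obtain e d where ed: "det (submatrix A {..<card N} N) = Poly_Mapping.single e d" "d \<noteq> 0"
      using lessThan_minor[OF less_imp_le[OF less] N refl] by blast
    then have "det (submatrix A {..<card N} N) \<noteq> 0" by (metis lookup_single_eq lookup_zero)
    ultimately have "det (submatrix A {..<card N} N) \<notin> var_ideal T"
      using free_of_var_ideal by blast
    moreover note rdet
    ultimately have "r \<in> var_ideal T"
      using primeideal_var_ideal[of T, where ?'k = 'k] by (auto simp: primeideal_class_ring_iff)
    then show ?thesis using var_ideal_subset[OF idp, of T] by (auto simp: T_def)
  qed
qed

text \<open>The primes above the annihilator are the union over \<open>i\<close> of the primes above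
  the ideals I_i, so the infimum of heights splits.\<close>

lemma INF_ideal_codim_lcm_ideal:
  "(INF i\<in>{1..s}. ideal_codim class_ring (lcm_ideal s l \<alpha> i :: ('n, 'k) mpoly set)) =
   ideal_codim class_ring (annihilator class_ring (mat_cokernel A))"
proof -
  have "{p. primeideal p class_ring \<and> annihilator class_ring (mat_cokernel A) \<subseteq> p} =
      (\<Union>i\<in>{1..s}. {p. primeideal p class_ring \<and> lcm_ideal s l \<alpha> i \<subseteq> p})" (is "?L = ?R")
  proof (intro equalityI subsetI)
    fix p assume "p \<in> ?L"
    then show "p \<in> ?R" using lcm_ideal_subset_if_annihilator_subset[of p] by simp
  next
    fix p assume "p \<in> ?R"
    then obtain i where "i \<in> {1..s}" "primeideal p class_ring" "lcm_ideal s l \<alpha> i \<subseteq> p" by blast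
    then show "p \<in> ?L" using annihilator_subset_if_lcm_ideal_subset[of p i] by simp
  qed
  then show ?thesis unfolding ideal_codim_def by (simp only: INF_UNION)
qed

text \<open>The hypothesis of \<open>krull_dim_quot_eq\<close> is met with \<open>T\<close> the set
  of all variables in p: containing I_i depends only on these, so \<open>var_ideal T\<close> also
  contains I_i and hence the annihilator.\<close>

lemma module_dim_mat_cokernel:
  "module_dim class_ring (mat_cokernel A) = ereal (real CARD('n)) -
   (INF i\<in>{1..s}. ideal_codim class_ring (lcm_ideal s l \<alpha> i :: ('n, 'k) mpoly set))"
  unfolding module_dim_def INF_ideal_codim_lcm_ideal
proof (rule krull_dim_quot_eq[OF ideal_annihilator_mat_cokernel])
  fix p :: "('n, 'k) mpoly set"
  assume p: "primeideal p class_ring" "annihilator class_ring (mat_cokernel A) \<subseteq> p"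
  then obtain i where i: "i \<in> {1..s}" "lcm_ideal s l \<alpha> i \<subseteq> p"
    using lcm_ideal_subset_if_annihilator_subset by blast
  define T where "T = {v. mvar v \<in> p}"
  have "lcm_ideal s l \<alpha> i \<subseteq> (var_ideal T :: ('n, 'k) mpoly set)"
    using i(2) unfolding lcm_ideal_subset_primeideal_iff[OF p(1)]
      lcm_ideal_subset_primeideal_iff[OF primeideal_var_ideal] mvar_mem_var_ideal_iff T_def mem_Collect_eq .
  then have "annihilator class_ring (mat_cokernel A) \<subseteq> var_ideal T"
    by (rule annihilator_subset_if_lcm_ideal_subset[OF primeideal_var_ideal i(1)])
  moreover have "var_ideal T \<subseteq> p"
    using p(1) by (intro var_ideal_subset) (auto simp: T_def primeideal_class_ring_iff)
  ultimately show "\<exists>T. annihilator class_ring (mat_cokernel A) \<subseteq> (var_ideal T :: ('n, 'k) mpoly set) \<and>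
      var_ideal T \<subseteq> p" by blast
qed

end

section \<open>From squarefree solutions to the locale, and the theorem\<close>

lemma squarefree_alternative:
  assumes E: "solves_E s l c \<alpha> \<gamma> \<beta>"
    and nz: "\<And>i j. i \<in> {1..s} \<Longrightarrow> j \<in> {1..l} \<Longrightarrow> c i j \<noteq> 0"
    and \<gamma>: "\<forall>j\<in>{1..l}. \<forall>v. \<gamma> j v \<in> {0, 1}" and \<beta>: "\<forall>i\<in>{1..s}. \<forall>v. \<beta> i v \<in> {0, 1}"
  shows "(\<forall>i\<in>{1..s}. \<forall>j\<in>{1..l}. \<forall>j'\<in>{1..l}.
         Poly_Mapping.lookup (\<alpha> i j) v = Poly_Mapping.lookup (\<alpha> i j') v) \<or>
      (\<forall>i\<in>{1..s}. \<forall>i'\<in>{1..s}. \<forall>j\<in>{1..l}.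
         Poly_Mapping.lookup (\<alpha> i j) v = Poly_Mapping.lookup (\<alpha> i' j) v)"
proof -
  have eq: "int (Poly_Mapping.lookup (\<alpha> i j) v) = \<gamma> j v - \<beta> i v" if "i \<in> {1..s}" "j \<in> {1..l}" for i j
    using E nz[OF that] that unfolding solves_E_def by metis
  show ?thesis
  proof (cases "\<exists>i\<in>{1..s}. \<beta> i v = 1")
    case True
    then obtain i where i: "i \<in> {1..s}" "\<beta> i v = 1" by blast
    \<comment> \<open>Exponents are nonnegative, so \<open>\<gamma> j v\<close> is at least
      \<open>\<beta> i v\<close>, which is 1.\<close>
    have one: "\<gamma> j v = 1" if j: "j \<in> {1..l}" for j
    proof -
      have "0 \<le> \<gamma> j v - \<beta> i v" unfolding eq[OF i(1) j, symmetric] by simp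
      then show ?thesis using \<gamma> j i(2) by force
    qed
    have "Poly_Mapping.lookup (\<alpha> i j) v = Poly_Mapping.lookup (\<alpha> i j') v"
      if "i \<in> {1..s}" "j \<in> {1..l}" "j' \<in> {1..l}" for i j j'
      using eq[OF that(1,2)] eq[OF that(1,3)] one[OF that(2)] one[OF that(3)] by linarith
    then show ?thesis by blast
  next
    case False
    then have zero: "\<beta> i v = 0" if "i \<in> {1..s}" for i using \<beta> that by blast
    have "Poly_Mapping.lookup (\<alpha> i j) v = Poly_Mapping.lookup (\<alpha> i' j) v"
      if "i \<in> {1..s}" "i' \<in> {1..s}" "j \<in> {1..l}" for i i' j
      using eq[OF that(1,3)] eq[OF that(2,3)] zero[OF that(1)] zero[OF that(2)] by linarith
    then show ?thesis by blast
  qed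
qed

lemma uniform_rank_entry_neq_0:
  assumes "uniform_rank A" "i < dim_row A" "j < dim_col A"
  shows "A $$ (i, j) \<noteq> 0"
proof -
  have "{a. a < dim_row A \<and> a \<in> {i}} = {i}" "{a. a < dim_col A \<and> a \<in> {j}} = {j}" using assms by auto
  moreover have "pick {i} 0 = i" "pick {j} 0 = j" by (auto intro: Least_equality)
  ultimately have "submatrix A {i} {j} = mat 1 1 (\<lambda>_. A $$ (i, j))"
    unfolding submatrix_def by (intro eq_matI) auto
  moreover have "det (submatrix A {i} {j}) \<noteq> 0"
    using assms unfolding uniform_rank_def by auto
  ultimately show ?thesis by (simp add: det_single)
qed

theorem corollary3p10:
  fixes s l :: nat
    and c :: "nat \<Rightarrow> nat \<Rightarrow> 'k::field_char_0"
    and \<alpha> :: "nat \<Rightarrow> nat \<Rightarrow> 'n::finite \<Rightarrow>\<^sub>0 nat"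
    and A :: "('n, 'k) mpoly mat"
  assumes A: "A = term_mat s l c \<alpha>"
    and multigraded: "multigraded A"
    and squarefree: "squarefree_system s l c \<alpha>"
    and uniform_rank: "uniform_rank A"
    and "s \<le> l"
  shows "module_codim (mat_cokernel A) =
           (INF j\<in>{1..s}. ideal_codim class_ring (lcm_ideal s l \<alpha> j :: ('n, 'k) mpoly set)) \<and>
         module_dim class_ring (mat_cokernel A) =
           ereal (real CARD('n)) -
           (INF j\<in>{1..s}. ideal_codim class_ring (lcm_ideal s l \<alpha> j :: ('n, 'k) mpoly set))"
proof -
  obtain \<gamma> \<beta> where sol: "solves_E s l c \<alpha> \<gamma> \<beta>"
    "\<forall>j\<in>{1..l}. \<forall>v. \<gamma> j v \<in> {0, 1}" "\<forall>i\<in>{1..s}. \<forall>v. \<beta> i v \<in> {0, 1}"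
    using squarefree unfolding squarefree_system_def by blast
  \<comment> \<open>By uniform rank the system has an equation for every pair (i, j).\<close>
  have nz: "c i j \<noteq> 0" if "i \<in> {1..s}" "j \<in> {1..l}" for i j
    using uniform_rank_entry_neq_0[OF uniform_rank, of "i - 1" "j - 1"] that
    by (cases i; cases j) (auto simp: A term_mat_def)
  interpret squarefree_uniform_matrix s l c \<alpha> A
    by (rule squarefree_uniform_matrix.intro[OF A multigraded uniform_rank
          squarefree_alternative[OF sol(1) nz sol(2,3)]])
  \<comment> \<open>Valid for infinite \<open>x\<close> too, because \<open>a\<close> is
    finite.\<close>
  have "ereal a - (ereal a - x) = x" for a x by (cases x) auto
  then show ?thesis unfolding module_codim_def module_dim_mat_cokernel by simp
qed

end
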